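(* Let $n\geq 3$ and let $\rho_{A_1A_2A_3}$ be a state (density matrix) on $H_{A_1}\otimes H_{A_2}\otimes H_{A_3}$ with $\dim H_{A_1}=\dim H_{A_2}=2$ and $\dim H_{A_3}=2^{n-2}$ (a $2\otimes 2\otimes 2^{n-2}$ state). Let $k\geq 1$, $\frac12\leq p\leq 1$, $r\geq 2$ and $0\leq \alpha\leq \frac r2$, and put $$l=\frac{(1+k)^{\alpha/r}-p^{\alpha/r}}{k^{\alpha/r}}.$$ (1) If $C^r(\rho_{A_1A_3})\geq k\,C^r(\rho_{A_1A_2})$, then $$C^\alpha(\rho_{A_1|A_2A_3})\geq p^{\alpha/r}C^\alpha(\rho_{A_1A_2})+l\,C^\alpha(\rho_{A_1A_3}).$$ (2) If $C^r(\rho_{A_1A_2})\geq k\,C^r(\rho_{A_1A_3})$, then $$C^\alpha(\rho_{A_1|A_2A_3})\geq p^{\alpha/r}C^\alpha(\rho_{A_1A_3})+l\,C^\alpha(\rho_{A_1A_2}).$$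
   Context: For a bipartite pure state $|\varphi\rangle_{XY}\in H_X\otimes H_Y$, its concurrence is $C(|\varphi\rangle)=\sqrt{2[1-\mathrm{tr}(\rho_X^2)]}$ where $\rho_X=\mathrm{tr}_Y|\varphi\rangle\langle\varphi|$. For a mixed bipartite state $\rho_{XY}$, $C(\rho_{XY})=\min\sum_i p_i C(|\varphi_i\rangle)$, the minimum over all pure-state ensembles $\{p_i,|\varphi_i\rangle\}$ with $\rho_{XY}=\sum_ip_i|\varphi_i\rangle\langle\varphi_i|$. $\rho_{A_1A_2}=\mathrm{tr}_{A_3}\rho_{A_1A_2A_3}$ and $\rho_{A_1A_3}=\mathrm{tr}_{A_2}\rho_{A_1A_2A_3}$ are reduced states, and $\rho_{A_1|A_2A_3}$ denotes $\rho_{A_1A_2A_3}$ regarded as a bipartite state with respect to the bipartition $A_1$ versus $A_2A_3$. $C^\alpha$ denotes the $\alpha$-th power of the concurrence. *)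

theory Defs
  imports Complex_Main
begin

text \<open>Finite-dimensional operators on C^N are represented as functions
  nat => nat => complex, only entries with indices below N being relevant;
  vectors of C^N as nat => complex.  Tensor products use the standard
  (lexicographic) index ordering: basis vector (a,b) of C^dX (x) C^dY has
  index a*dY + b.\<close>

definition is_state :: "nat \<Rightarrow> (nat \<Rightarrow> nat \<Rightarrow> complex) \<Rightarrow> bool" where
  "is_state N \<rho> \<longleftrightarrow>
     (\<forall>i<N. \<forall>j<N. \<rho> j i = cnj (\<rho> i j)) \<and>
     (\<forall>v :: nat \<Rightarrow> complex. 0 \<le> Re (\<Sum>i<N. \<Sum>j<N. cnj (v i) * \<rho> i j * v j)) \<and>
     (\<Sum>i<N. \<rho> i i) = 1"

definition unit_vec :: "nat \<Rightarrow> (nat \<Rightarrow> complex) \<Rightarrow> bool" where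
  "unit_vec N \<phi> \<longleftrightarrow> (\<Sum>i<N. (cmod (\<phi> i))\<^sup>2) = 1"

definition reduced_pure :: "nat \<Rightarrow> (nat \<Rightarrow> complex) \<Rightarrow> nat \<Rightarrow> nat \<Rightarrow> complex" where
  "reduced_pure dY \<phi> i j = (\<Sum>b<dY. \<phi> (i * dY + b) * cnj (\<phi> (j * dY + b)))"

definition conc_pure :: "nat \<Rightarrow> nat \<Rightarrow> (nat \<Rightarrow> complex) \<Rightarrow> real" where
  "conc_pure dX dY \<phi> =
     sqrt (2 * (1 - Re (\<Sum>i<dX. \<Sum>j<dX. reduced_pure dY \<phi> i j * reduced_pure dY \<phi> j i)))"

definition is_ensemble :: "nat \<Rightarrow> (nat \<Rightarrow> nat \<Rightarrow> complex) \<Rightarrow> (real \<times> (nat \<Rightarrow> complex)) list \<Rightarrow> bool" where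
  "is_ensemble N \<rho> E \<longleftrightarrow>
     (\<forall>(p, \<phi>) \<in> set E. 0 \<le> p \<and> unit_vec N \<phi>) \<and>
     sum_list (map fst E) = 1 \<and>
     (\<forall>i<N. \<forall>j<N. \<rho> i j = (\<Sum>(p, \<phi>)\<leftarrow>E. of_real p * \<phi> i * cnj (\<phi> j)))"

definition conc :: "nat \<Rightarrow> nat \<Rightarrow> (nat \<Rightarrow> nat \<Rightarrow> complex) \<Rightarrow> real" where
  "conc dX dY \<rho> =
     Inf {(\<Sum>(p, \<phi>)\<leftarrow>E. p * conc_pure dX dY \<phi>) | E. is_ensemble (dX * dY) \<rho> E}"

definition ptrace_last :: "nat \<Rightarrow> (nat \<Rightarrow> nat \<Rightarrow> complex) \<Rightarrow> nat \<Rightarrow> nat \<Rightarrow> complex" where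
  "ptrace_last d3 \<rho> a b = (\<Sum>c<d3. \<rho> (a * d3 + c) (b * d3 + c))"

definition ptrace_mid :: "nat \<Rightarrow> nat \<Rightarrow> (nat \<Rightarrow> nat \<Rightarrow> complex) \<Rightarrow> nat \<Rightarrow> nat \<Rightarrow> complex" where
  "ptrace_mid d2 d3 \<rho> a b =
     (\<Sum>m<d2. \<rho> ((a div d3) * (d2 * d3) + m * d3 + a mod d3)
               ((b div d3) * (d2 * d3) + m * d3 + b mod d3))"

end

theory Submission
  imports Defs
begin

text \<open>
  The heart is the monogamy inequality \<open>C\<^sub>1\<^sub>|\<^sub>2\<^sub>3\<^sup>2 \<ge> C\<^sub>1\<^sub>2\<^sup>2 + C\<^sub>1\<^sub>3\<^sup>2\<close>. For a pure state write
  \<open>x\<^sub>b, y\<^sub>b\<close> for the vectors of the third factor with first index 0, 1 and second index \<open>b\<close>. Half of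
  \<open>C\<^sub>1\<^sub>|\<^sub>2\<^sub>3\<close> has the square \<open>|x\<^sub>0 \<and> y\<^sub>0|\<^sup>2 + |x\<^sub>1 \<and> y\<^sub>1|\<^sup>2 + |N|\<^sup>2\<close>, where \<open>N = x\<^sub>0 y\<^sub>1\<^sup>T - y\<^sub>0 x\<^sub>1\<^sup>T\<close> has
  rank two and singular values with product \<open>|x\<^sub>0 \<and> y\<^sub>0| |x\<^sub>1 \<and> y\<^sub>1|\<close>. So it equals
  \<open>(|x\<^sub>0 \<and> y\<^sub>0| + |x\<^sub>1 \<and> y\<^sub>1|)\<^sup>2 + (n\<^sub>1 - n\<^sub>2)\<^sup>2\<close>. The first base is half the cost of the ensemble of the
  (1,3)-state obtained by measuring the second factor. The (1,2)-state has an ensemble of half cost at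
  most \<open>n\<^sub>1 - n\<^sub>2\<close>: with principal vectors of the spans of \<open>x\<^sub>0, y\<^sub>0\<close> and \<open>x\<^sub>1, y\<^sub>1\<close> it is the mean of two
  states of rank two with the same diagonal blocks, and each of them splits into a product vector and a
  vector of half concurrence at most \<open>n\<^sub>1 - n\<^sub>2\<close>. Mixed states follow from Minkowski's inequality.
  The theorem then reduces to the monotonicity of \<open>((1 + s)\<^sup>t - p\<^sup>t) / s\<^sup>t\<close> in \<open>s \<ge> 1\<close> for \<open>t \<le> 1/2\<close>.
\<close>

section \<open>Inner products and two-dimensional linear algebra\<close>

text \<open>Linear in the first argument, so that inner products of the blocks of a vector are the
  entries of its partial trace and not their conjugates.\<close>

definition ip :: "nat \<Rightarrow> (nat \<Rightarrow> complex) \<Rightarrow> (nat \<Rightarrow> complex) \<Rightarrow> complex" where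
  "ip d x y = (\<Sum>c<d. x c * cnj (y c))"

definition nsq :: "nat \<Rightarrow> (nat \<Rightarrow> complex) \<Rightarrow> real" where
  "nsq d x = (\<Sum>c<d. (cmod (x c))\<^sup>2)"

text \<open>The squared norm of the wedge product of \<open>x\<close> and \<open>y\<close>.\<close>

definition gramdet :: "nat \<Rightarrow> (nat \<Rightarrow> complex) \<Rightarrow> (nat \<Rightarrow> complex) \<Rightarrow> real" where
  "gramdet d x y = nsq d x * nsq d y - (cmod (ip d x y))\<^sup>2"

lemma nsq_nonneg [simp]: "0 \<le> nsq d x"
  by (simp add: nsq_def sum_nonneg)

lemma nsq_eq_0_iff: "nsq d x = 0 \<longleftrightarrow> (\<forall>c<d. x c = 0)"
  unfolding nsq_def by (subst sum_nonneg_eq_0_iff) auto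

lemma ip_self: "ip d x x = of_real (nsq d x)"
  unfolding ip_def nsq_def of_real_sum complex_norm_square ..

lemma ip_cnj: "cnj (ip d x y) = ip d y x"
  unfolding ip_def by (simp add: mult.commute)

lemma ip_cmul_left: "ip d (\<lambda>c. a * x c) y = a * ip d x y"
  unfolding ip_def by (simp add: sum_distrib_left mult_ac)

lemma ip_cmul_right: "ip d x (\<lambda>c. a * y c) = cnj a * ip d x y"
  unfolding ip_def by (simp add: sum_distrib_left mult_ac)

lemma ip_add_left: "ip d (\<lambda>c. x c + y c) z = ip d x z + ip d y z"
  unfolding ip_def by (simp add: sum.distrib algebra_simps)

lemma ip_add_right: "ip d x (\<lambda>c. y c + z c) = ip d x y + ip d x z"
  unfolding ip_def by (simp add: sum.distrib algebra_simps)

lemma ip_diff_left: "ip d (\<lambda>c. x c - y c) z = ip d x z - ip d y z"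
  unfolding ip_def by (simp add: sum_subtractf algebra_simps)

lemma ip_diff_right: "ip d x (\<lambda>c. y c - z c) = ip d x y - ip d x z"
  unfolding ip_def by (simp add: sum_subtractf algebra_simps)

lemmas ip_linear = ip_cmul_left ip_cmul_right ip_add_left ip_add_right ip_diff_left ip_diff_right

lemma ip_cong: "(\<And>c. c < d \<Longrightarrow> x c = x' c) \<Longrightarrow> (\<And>c. c < d \<Longrightarrow> y c = y' c) \<Longrightarrow> ip d x y = ip d x' y'"
  unfolding ip_def by (intro sum.cong) auto

lemma nsq_cmul: "nsq d (\<lambda>c. a * x c) = (cmod a)\<^sup>2 * nsq d x"
  unfolding nsq_def by (simp add: norm_mult power_mult_distrib sum_distrib_left)

text \<open>For nonzero \<open>y\<close>, the vector \<open>?z\<close> is the component of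
  \<open>x\<close> orthogonal to \<open>y\<close>, scaled by \<open>nsq d y\<close> to avoid
  division; its squared norm is \<open>nsq d y\<close> times the Gram determinant.\<close>

lemma gramdet_nonneg: "0 \<le> gramdet d x y"
proof (cases "nsq d y = 0")
  case True
  then have "ip d x y = 0" by (simp add: nsq_eq_0_iff ip_def)
  then show ?thesis using True by (simp add: gramdet_def)
next
  case False
  then have pos: "0 < nsq d y" using nsq_nonneg[of d y] by linarith
  let ?n = "complex_of_real (nsq d y)"
  let ?z = "\<lambda>c. ?n * x c - ip d x y * y c"
  have "complex_of_real (nsq d ?z) = ip d ?z ?z" by (simp add: ip_self)
  also have "\<dots> = ?n * (?n * ip d x x - ip d x y * cnj (ip d x y))"
    by (simp only: ip_linear) (simp add: ip_self ip_cnj[symmetric, of d x y] algebra_simps)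
  also have "\<dots> = of_real (nsq d y * gramdet d x y)"
    by (simp only: gramdet_def ip_self complex_norm_square[symmetric] of_real_mult of_real_diff mult_ac)
  finally have "nsq d ?z = nsq d y * gramdet d x y" by (simp only: of_real_eq_iff)
  then have "0 \<le> nsq d y * gramdet d x y" by (metis nsq_nonneg)
  then show ?thesis using pos by (simp add: zero_le_mult_iff)
qed

lemma ip_Cauchy_Schwarz: "(cmod (ip d x y))\<^sup>2 \<le> nsq d x * nsq d y"
  using gramdet_nonneg[of d x y] by (simp add: gramdet_def)

text \<open>As \<open>inverse 0 = 0\<close>, a vector of norm zero is sent to zero, so
  \<open>nrm_scale\<close> holds without exception.\<close>

definition nrm :: "nat \<Rightarrow> (nat \<Rightarrow> complex) \<Rightarrow> nat \<Rightarrow> complex" where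
  "nrm d x = (\<lambda>c. complex_of_real (inverse (sqrt (nsq d x))) * x c)"

lemma nrm_scale: "c < d \<Longrightarrow> x c = of_real (sqrt (nsq d x)) * nrm d x c"
  by (cases "nsq d x = 0") (auto simp: nrm_def nsq_eq_0_iff)

lemma nsq_nrm: "nsq d (nrm d x) = (if nsq d x = 0 then 0 else 1)"
  by (auto simp: nrm_def nsq_cmul norm_inverse power_inverse)

lemma ip_nrm_left: "ip d (nrm d x) y = of_real (inverse (sqrt (nsq d x))) * ip d x y"
  by (simp add: nrm_def ip_cmul_left)

text \<open>The orthonormal pair \<open>f, g\<close> is allowed to contain zero vectors, so that linearly
  dependent \<open>x, y\<close> need no separate treatment.\<close>

lemma Gram_Schmidt_pair:
  obtains a b0 b1 :: complex and f g :: "nat \<Rightarrow> complex"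
  where "\<And>c. c < d \<Longrightarrow> x c = a * f c" "\<And>c. c < d \<Longrightarrow> y c = b0 * f c + b1 * g c"
    "ip d x x = a * cnj a" "ip d x y = a * cnj b0" "ip d y y = b0 * cnj b0 + b1 * cnj b1"
    "\<And>s t. nsq d (\<lambda>c. s * f c + t * g c) \<le> (cmod s)\<^sup>2 + (cmod t)\<^sup>2"
proof -
  define f where "f = nrm d x"
  define a where "a = complex_of_real (sqrt (nsq d x))"
  define b0 where "b0 = ip d y f"
  define y' where "y' = (\<lambda>c. y c - b0 * f c)"
  define g where "g = nrm d y'"
  define b1 where "b1 = complex_of_real (sqrt (nsq d y'))"
  have x: "x c = a * f c" if "c < d" for c using nrm_scale[OF that] by (simp add: a_def f_def)
  have y: "y c = b0 * f c + b1 * g c" if "c < d" for c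
    using nrm_scale[OF that, of y'] unfolding b1_def g_def by (simp add: y'_def algebra_simps)
  \<comment> \<open>Either \<open>f\<close> is a unit vector or it vanishes and is orthogonal to
    everything; subtracting \<open>b0 * f\<close> leaves a vector orthogonal to \<open>f\<close> in
    both cases.\<close>
  have ff: "ip d f f = 0 \<and> (\<forall>z. ip d z f = 0) \<or> ip d f f = 1"
  proof (cases "nsq d x = 0")
    case True
    then have "\<forall>c<d. f c = 0" by (simp add: f_def nrm_def)
    then show ?thesis by (simp add: ip_def)
  next
    case False
    then show ?thesis by (simp add: ip_self f_def nsq_nrm)
  qed
  have "ip d y' f = 0" using ff by (auto simp: y'_def ip_linear b0_def)
  then have gf: "ip d g f = 0" by (simp add: g_def ip_nrm_left)
  then have fg: "ip d f g = 0" using ip_cnj[of d g f] by simp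
  have aa: "ip d x x = a * cnj a"
    by (simp add: ip_self a_def flip: of_real_mult)
  have xy: "ip d x y = a * cnj b0"
  proof -
    have "ip d x y = ip d (\<lambda>c. a * f c) y" by (rule ip_cong) (auto simp: x)
    then show ?thesis by (simp add: ip_linear b0_def ip_cnj)
  qed
  \<comment> \<open>If \<open>g\<close> vanishes, so does \<open>b1\<close>, and its missing unit
    norm does no harm.\<close>
  have gg: "b1 * cnj b1 * ip d g g = b1 * cnj b1"
    by (auto simp: b1_def ip_self g_def nsq_nrm)
  have bf: "b0 * cnj b0 * ip d f f = b0 * cnj b0"
    using ff by (auto simp: b0_def)
  have yy: "ip d y y = b0 * cnj b0 + b1 * cnj b1"
  proof -
    have "ip d y y = ip d (\<lambda>c. b0 * f c + b1 * g c) (\<lambda>c. b0 * f c + b1 * g c)"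
      by (rule ip_cong) (auto simp: y)
    also have "\<dots> = b0 * cnj b0 * ip d f f + b1 * cnj b1 * ip d g g"
      by (simp add: ip_linear fg gf algebra_simps)
    finally show ?thesis using gg bf by simp
  qed
  have "nsq d (\<lambda>c. s * f c + t * g c) \<le> (cmod s)\<^sup>2 + (cmod t)\<^sup>2" for s t
  proof -
    have "complex_of_real (nsq d (\<lambda>c. s * f c + t * g c)) = s * cnj s * ip d f f + t * cnj t * ip d g g"
      by (simp add: ip_self[symmetric] ip_linear fg gf algebra_simps)
    also have "\<dots> = of_real ((cmod s)\<^sup>2 * nsq d f + (cmod t)\<^sup>2 * nsq d g)"
      by (simp only: ip_self complex_norm_square[symmetric] of_real_add of_real_mult)
    finally have "nsq d (\<lambda>c. s * f c + t * g c) = (cmod s)\<^sup>2 * nsq d f + (cmod t)\<^sup>2 * nsq d g"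
      by (simp only: of_real_eq_iff)
    also have "\<dots> \<le> (cmod s)\<^sup>2 * 1 + (cmod t)\<^sup>2 * 1"
      by (intro add_mono mult_left_mono) (auto simp: f_def g_def nsq_nrm)
    finally show ?thesis by simp
  qed
  then show ?thesis using that x y aa xy yy by blast
qed

section \<open>Unitary normal forms of complex 2x2 matrices\<close>

lemma unit_pair_exists:
  fixes x0 x1 :: complex
  assumes "x0 \<noteq> 0 \<or> x1 \<noteq> 0"
  obtains u0 u1 s where "s \<noteq> 0" "x0 = s * u0" "x1 = s * u1" "u0 * cnj u0 + u1 * cnj u1 = 1"
proof -
  let ?n = "(cmod x0)\<^sup>2 + (cmod x1)\<^sup>2"
  have pos: "?n > 0" using assms by (auto simp: add_pos_nonneg add_nonneg_pos)
  let ?s = "complex_of_real (sqrt ?n)"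
  have s: "?s \<noteq> 0" using pos by (simp only: of_real_eq_0_iff real_sqrt_eq_zero_cancel_iff)
  have ss: "?s * ?s = x0 * cnj x0 + x1 * cnj x1"
    using pos by (simp add: complex_norm_square[symmetric] flip: of_real_mult)
  show ?thesis
  proof (rule that[of ?s "x0 / ?s" "x1 / ?s"])
    have "x0 / ?s * cnj (x0 / ?s) + x1 / ?s * cnj (x1 / ?s) = (x0 * cnj x0 + x1 * cnj x1) / (?s * ?s)"
      by (simp add: add_divide_distrib)
    also have "\<dots> = 1" using ss s by (metis divide_self mult_eq_0_iff)
    finally show "x0 / ?s * cnj (x0 / ?s) + x1 / ?s * cnj (x1 / ?s) = 1" .
  qed (use s in auto)
qed

text \<open>A projective root: \<open>(1, 0)\<close> if the leading coefficient vanishes, otherwise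
  the quadratic formula with second coordinate 1.\<close>

lemma binary_quadratic_root:
  fixes a b c :: complex
  obtains x y where "x \<noteq> 0 \<or> y \<noteq> 0" "a * x\<^sup>2 + b * x * y + c * y\<^sup>2 = 0"
proof (cases "a = 0")
  case True
  then show ?thesis using that[of 1 0] by simp
next
  case False
  define s where "s = csqrt (b\<^sup>2 - 4 * a * c)"
  have "s\<^sup>2 = b\<^sup>2 - 4 * a * c" by (simp add: s_def)
  then have "a * ((- b + s) / (2 * a))\<^sup>2 + b * ((- b + s) / (2 * a)) * 1 + c * 1\<^sup>2 = 0"
    using False by (simp add: field_simps power2_eq_square) algebra
  then show ?thesis using that[of "(- b + s) / (2 * a)" 1] by simp
qed

text \<open>Rotating the first basis vector to a zero of the quadratic form makes the diagonal of the
  rotated matrix \<open>N\<close> equal to \<open>(0, m\<^sub>1\<^sub>1)\<close>, and then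
  \<open>|m\<^sub>1\<^sub>1|\<^sup>2 = |N|\<^sup>2 - |m\<^sub>0\<^sub>1|\<^sup>2 - |m\<^sub>1\<^sub>0|\<^sup>2 \<le> |N|\<^sup>2 - 2 |m\<^sub>0\<^sub>1 m\<^sub>1\<^sub>0|\<close>.\<close>

lemma rotate_to_zero_diagonal:
  fixes n00 n01 n10 n11 :: complex
  obtains w0 w1 where "w0 * cnj w0 + w1 * cnj w1 = 1"
    "n00 * w0 * w0 + n01 * w0 * w1 + n10 * w1 * w0 + n11 * w1 * w1 = 0"
    "(cmod (n00 * cnj w1 * cnj w1 - n01 * cnj w1 * cnj w0 - n10 * cnj w0 * cnj w1 + n11 * cnj w0 * cnj w0))\<^sup>2
      \<le> (cmod n00)\<^sup>2 + (cmod n01)\<^sup>2 + (cmod n10)\<^sup>2 + (cmod n11)\<^sup>2 - 2 * cmod (n00 * n11 - n01 * n10)"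
proof -
  obtain x y where xy: "x \<noteq> 0 \<or> y \<noteq> 0" "n00 * x\<^sup>2 + (n01 + n10) * x * y + n11 * y\<^sup>2 = 0"
    by (rule binary_quadratic_root)
  obtain w0 w1 s where w: "s \<noteq> 0" "x = s * w0" "y = s * w1" "w0 * cnj w0 + w1 * cnj w1 = 1"
    by (rule unit_pair_exists[OF xy(1)])
  have "s\<^sup>2 * (n00 * w0 * w0 + n01 * w0 * w1 + n10 * w1 * w0 + n11 * w1 * w1) = 0"
    using xy(2) w(2,3) by (simp add: power2_eq_square algebra_simps)
  then have m00: "n00 * w0 * w0 + n01 * w0 * w1 + n10 * w1 * w0 + n11 * w1 * w1 = 0"
    using w(1) by simp
  \<comment> \<open>\<open>w\<close> and \<open>v\<close> are the columns of a unitary matrix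
    \<open>W\<close> of determinant one, and the \<open>m\<close> are entries of
    \<open>W^T N W\<close>; determinant and Frobenius norm of \<open>N\<close> are
    preserved.\<close>
  define v0 v1 where "v0 = - cnj w1" and "v1 = cnj w0"
  define m01 where "m01 = n00 * w0 * v0 + n01 * w0 * v1 + n10 * w1 * v0 + n11 * w1 * v1"
  define m10 where "m10 = n00 * v0 * w0 + n01 * v0 * w1 + n10 * v1 * w0 + n11 * v1 * w1"
  define m11 where "m11 = n00 * v0 * v0 + n01 * v0 * v1 + n10 * v1 * v0 + n11 * v1 * v1"
  have det: "n00 * n11 - n01 * n10 = - (m01 * m10)"
    using w(4) m00 unfolding m01_def m10_def v0_def v1_def by algebra
  have "m01 * cnj m01 + m10 * cnj m10 + m11 * cnj m11
      = n00 * cnj n00 + n01 * cnj n01 + n10 * cnj n10 + n11 * cnj n11"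
  proof -
    have m00': "cnj n00 * cnj w0 * cnj w0 + cnj n01 * cnj w0 * cnj w1 + cnj n10 * cnj w1 * cnj w0
        + cnj n11 * cnj w1 * cnj w1 = 0"
      using arg_cong[OF m00, of cnj] by simp
    show ?thesis
      using w(4) m00 m00' unfolding m01_def m10_def m11_def v0_def v1_def
      by simp algebra
  qed
  then have "complex_of_real ((cmod m01)\<^sup>2 + (cmod m10)\<^sup>2 + (cmod m11)\<^sup>2)
      = complex_of_real ((cmod n00)\<^sup>2 + (cmod n01)\<^sup>2 + (cmod n10)\<^sup>2 + (cmod n11)\<^sup>2)"
    by (simp only: of_real_add complex_norm_square)
  then have nn: "(cmod m01)\<^sup>2 + (cmod m10)\<^sup>2 + (cmod m11)\<^sup>2
      = (cmod n00)\<^sup>2 + (cmod n01)\<^sup>2 + (cmod n10)\<^sup>2 + (cmod n11)\<^sup>2"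
    by (simp only: of_real_eq_iff)
  have "2 * (cmod m01 * cmod m10) \<le> (cmod m01)\<^sup>2 + (cmod m10)\<^sup>2"
    using sum_squares_bound[of "cmod m01" "cmod m10"] by simp
  then have "(cmod m11)\<^sup>2 \<le> (cmod n00)\<^sup>2 + (cmod n01)\<^sup>2 + (cmod n10)\<^sup>2 + (cmod n11)\<^sup>2
      - 2 * cmod (n00 * n11 - n01 * n10)"
    using nn by (simp add: det norm_mult)
  then show ?thesis
    using that[OF w(4) m00] by (simp add: m11_def v0_def v1_def)
qed

text \<open>The singular vectors \<open>v\<close>, \<open>v\<^sub>\<bottom>\<close> are found from the orthogonality of their images, which is a
  binary quadratic equation for \<open>v\<close>.\<close>

lemma svd_2x2_contraction:
  fixes k00 k01 k10 k11 :: complex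
  assumes contr: "\<And>s0 s1 t0 t1. (cmod (s0 * k00 * t0 + s0 * k01 * t1 + s1 * k10 * t0 + s1 * k11 * t1))\<^sup>2
      \<le> ((cmod s0)\<^sup>2 + (cmod s1)\<^sup>2) * ((cmod t0)\<^sup>2 + (cmod t1)\<^sup>2)"
  obtains u0 u1 v0 v1 c e where
    "u0 * cnj u0 + u1 * cnj u1 = 1" "v0 * cnj v0 + v1 * cnj v1 = 1" "cmod c \<le> 1" "cmod e \<le> 1"
    "k00 = c * u0 * cnj v0 + e * cnj u1 * v1" "k01 = c * u0 * cnj v1 - e * cnj u1 * v0"
    "k10 = c * u1 * cnj v0 - e * cnj u0 * v1" "k11 = c * u1 * cnj v1 + e * cnj u0 * v0"
proof -
  \<comment> \<open>The \<open>h\<close> are the entries of \<open>K^* K\<close>. The quadratic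
    equation says that the images under \<open>K\<close> of \<open>v\<close> and of
    \<open>(- cnj v1, cnj v0)\<close>, called \<open>a\<close> and \<open>b\<close> below, are
    orthogonal.\<close>
  define h00 where "h00 = cnj k00 * k00 + cnj k10 * k10"
  define h01 where "h01 = cnj k00 * k01 + cnj k10 * k11"
  define h10 where "h10 = cnj k01 * k00 + cnj k11 * k10"
  define h11 where "h11 = cnj k01 * k01 + cnj k11 * k11"
  obtain x y where xy: "x \<noteq> 0 \<or> y \<noteq> 0" "h10 * x\<^sup>2 + (h11 - h00) * x * y + (- h01) * y\<^sup>2 = 0"
    by (rule binary_quadratic_root)
  obtain v0 v1 s where v: "s \<noteq> 0" "x = s * v0" "y = s * v1" "v0 * cnj v0 + v1 * cnj v1 = 1"
    by (rule unit_pair_exists[OF xy(1)])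
  have "s\<^sup>2 * (h10 * v0 * v0 + (h11 - h00) * v0 * v1 - h01 * v1 * v1) = 0"
    using xy(2) v(2,3) by (simp add: power2_eq_square algebra_simps)
  then have hv: "h10 * v0 * v0 + (h11 - h00) * v0 * v1 - h01 * v1 * v1 = 0"
    using v(1) by simp
  define a0 where "a0 = k00 * v0 + k01 * v1"
  define a1 where "a1 = k10 * v0 + k11 * v1"
  define b0 where "b0 = - k00 * cnj v1 + k01 * cnj v0"
  define b1 where "b1 = - k10 * cnj v1 + k11 * cnj v0"
  have orth: "a0 * cnj b0 + a1 * cnj b1 = 0"
    using hv unfolding h00_def h01_def h10_def h11_def a0_def a1_def b0_def b1_def
    by simp algebra
  have orth': "cnj a0 * b0 + cnj a1 * b1 = 0"
    using arg_cong[OF orth, of cnj] by simp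
  \<comment> \<open>The vectors orthogonal to a unit vector \<open>u\<close> of the plane are the
    multiples of \<open>(- cnj u1, cnj u0)\<close>. Here \<open>u\<close> comes from
    \<open>a\<close>, or from \<open>b\<close> if \<open>a\<close> vanishes; if both vanish, any
    unit vector serves.\<close>
  have "\<exists>u0 u1 c e. u0 * cnj u0 + u1 * cnj u1 = 1 \<and> a0 = c * u0 \<and> a1 = c * u1
      \<and> b0 = - e * cnj u1 \<and> b1 = e * cnj u0"
  proof (cases "a0 \<noteq> 0 \<or> a1 \<noteq> 0")
    case True
    then obtain u0 u1 t where u: "t \<noteq> 0" "a0 = t * u0" "a1 = t * u1" "u0 * cnj u0 + u1 * cnj u1 = 1"
      by (rule unit_pair_exists)
    have "cnj t * (cnj u0 * b0 + cnj u1 * b1) = 0"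
      using orth' u(2,3) by (simp add: algebra_simps)
    then have ub: "cnj u0 * b0 + cnj u1 * b1 = 0" using u(1) by simp
    let ?e = "b1 * u0 - b0 * u1"
    have "b0 = - ?e * cnj u1" "b1 = ?e * cnj u0" using ub u(4) by algebra+
    then show ?thesis using u by blast
  next
    case False
    show ?thesis
    proof (cases "b0 \<noteq> 0 \<or> b1 \<noteq> 0")
      case True
      then obtain u0 u1 t where u: "t \<noteq> 0" "b0 = t * u0" "b1 = t * u1" "u0 * cnj u0 + u1 * cnj u1 = 1"
        by (rule unit_pair_exists)
      show ?thesis using False u
        by (intro exI[of _ "cnj u1"] exI[of _ "- cnj u0"] exI[of _ 0] exI[of _ t])
          (simp add: algebra_simps)
    next
      case b: False
      show ?thesis using False b
        by (intro exI[of _ 1] exI[of _ 0]) simp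
    qed
  qed
  then obtain u0 u1 c e where u: "u0 * cnj u0 + u1 * cnj u1 = 1" and a: "a0 = c * u0" "a1 = c * u1"
    and b: "b0 = - e * cnj u1" "b1 = e * cnj u0" by blast
  have norm1: "(cmod z0)\<^sup>2 + (cmod z1)\<^sup>2 = 1" if "z0 * cnj z0 + z1 * cnj z1 = 1" for z0 z1
  proof -
    have "complex_of_real ((cmod z0)\<^sup>2 + (cmod z1)\<^sup>2) = of_real 1"
      using that by (simp only: of_real_add complex_norm_square of_real_1)
    then show ?thesis by (simp only: of_real_eq_iff)
  qed
  \<comment> \<open>\<open>c\<close> and \<open>e\<close> are values of the bilinear form at pairs
    of unit vectors, so the contraction property bounds them by one.\<close>
  have "cnj u0 * k00 * v0 + cnj u0 * k01 * v1 + cnj u1 * k10 * v0 + cnj u1 * k11 * v1 = c"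
    using a u unfolding a0_def a1_def by algebra
  then have "(cmod c)\<^sup>2 \<le> 1"
    using contr[of "cnj u0" v0 v1 "cnj u1"] by (simp add: norm1[OF u] norm1[OF v(4)])
  then have c: "cmod c \<le> 1" by (simp add: abs_square_le_1)
  have "- u1 * k00 * - cnj v1 + - u1 * k01 * cnj v0 + u0 * k10 * - cnj v1 + u0 * k11 * cnj v0 = e"
    using b u unfolding b0_def b1_def by algebra
  then have "(cmod e)\<^sup>2 \<le> 1"
    using contr[of "- u1" "- cnj v1" "cnj v0" u0] norm1[OF u] norm1[OF v(4)] by (simp add: add.commute)
  then have e: "cmod e \<le> 1" by (simp add: abs_square_le_1)
  show ?thesis
  proof (rule that[OF u v(4) c e])
    show "k00 = c * u0 * cnj v0 + e * cnj u1 * v1" using a b v(4) unfolding a0_def b0_def by algebra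
    show "k01 = c * u0 * cnj v1 - e * cnj u1 * v0" using a b v(4) unfolding a0_def b0_def by algebra
    show "k10 = c * u1 * cnj v0 - e * cnj u0 * v1" using a b v(4) unfolding a1_def b1_def by algebra
    show "k11 = c * u1 * cnj v1 + e * cnj u0 * v0" using a b v(4) unfolding a1_def b1_def by algebra
  qed
qed

section \<open>Principal vectors and decompositions of Gram matrices\<close>

text \<open>Vectors of even index are expanded in one (possibly degenerate) orthonormal pair, those
  of odd index in another. The singular value decomposition of the overlap matrix rotates both pairs
  until only corresponding members overlap, with overlaps \<open>c\<close> and
  \<open>e\<close>.\<close>

lemma principal_coordinates:
  fixes V :: "nat \<Rightarrow> nat \<Rightarrow> complex"
  obtains X Y :: "nat \<Rightarrow> complex" and c e :: complex where "cmod c \<le> 1" "cmod e \<le> 1"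
    "\<And>i j. i \<in> {0, 2} \<Longrightarrow> j \<in> {0, 2} \<Longrightarrow> ip d (V i) (V j) = X i * cnj (X j) + Y i * cnj (Y j)"
    "\<And>i j. i \<in> {1, 3} \<Longrightarrow> j \<in> {1, 3} \<Longrightarrow> ip d (V i) (V j) = X i * cnj (X j) + Y i * cnj (Y j)"
    "\<And>i j. i \<in> {0, 2} \<Longrightarrow> j \<in> {1, 3} \<Longrightarrow> ip d (V i) (V j) = c * X i * cnj (X j) + e * Y i * cnj (Y j)"
proof -
  obtain a b0 b1 f g where F: "\<And>c. c < d \<Longrightarrow> V 0 c = a * f c" "\<And>c. c < d \<Longrightarrow> V 2 c = b0 * f c + b1 * g c"
    "ip d (V 0) (V 0) = a * cnj a" "ip d (V 0) (V 2) = a * cnj b0" "ip d (V 2) (V 2) = b0 * cnj b0 + b1 * cnj b1"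
    "\<And>s t. nsq d (\<lambda>c. s * f c + t * g c) \<le> (cmod s)\<^sup>2 + (cmod t)\<^sup>2"
    by (rule Gram_Schmidt_pair[of d "V 0" "V 2"]) (rule that)
  obtain p q0 q1 h k where G: "\<And>c. c < d \<Longrightarrow> V 1 c = p * h c" "\<And>c. c < d \<Longrightarrow> V 3 c = q0 * h c + q1 * k c"
    "ip d (V 1) (V 1) = p * cnj p" "ip d (V 1) (V 3) = p * cnj q0" "ip d (V 3) (V 3) = q0 * cnj q0 + q1 * cnj q1"
    "\<And>s t. nsq d (\<lambda>c. s * h c + t * k c) \<le> (cmod s)\<^sup>2 + (cmod t)\<^sup>2"
    by (rule Gram_Schmidt_pair[of d "V 1" "V 3"]) (rule that)
  have F': "ip d (V 2) (V 0) = cnj a * b0" and G': "ip d (V 3) (V 1) = cnj p * q0"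
    using ip_cnj[of d "V 0" "V 2"] ip_cnj[of d "V 1" "V 3"] F(4) G(4) by simp_all
  \<comment> \<open>Cauchy-Schwarz makes the overlap matrix a contraction; vanishing members of a
    pair only lower the norms.\<close>
  have contr: "(cmod (s0 * ip d f h * t0 + s0 * ip d f k * t1 + s1 * ip d g h * t0 + s1 * ip d g k * t1))\<^sup>2
      \<le> ((cmod s0)\<^sup>2 + (cmod s1)\<^sup>2) * ((cmod t0)\<^sup>2 + (cmod t1)\<^sup>2)" for s0 s1 t0 t1
  proof -
    let ?x = "\<lambda>c. s0 * f c + s1 * g c" and ?y = "\<lambda>c. cnj t0 * h c + cnj t1 * k c"
    have "s0 * ip d f h * t0 + s0 * ip d f k * t1 + s1 * ip d g h * t0 + s1 * ip d g k * t1 = ip d ?x ?y"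
      by (simp add: ip_linear algebra_simps)
    moreover have "(cmod (ip d ?x ?y))\<^sup>2 \<le> nsq d ?x * nsq d ?y" by (rule ip_Cauchy_Schwarz)
    moreover have "nsq d ?x * nsq d ?y \<le> ((cmod s0)\<^sup>2 + (cmod s1)\<^sup>2) * ((cmod t0)\<^sup>2 + (cmod t1)\<^sup>2)"
      using F(6)[of s0 s1] G(6)[of "cnj t0" "cnj t1"] by (intro mult_mono) auto
    ultimately show ?thesis by simp
  qed
  obtain u0 u1 v0 v1 c e where S: "u0 * cnj u0 + u1 * cnj u1 = 1" "v0 * cnj v0 + v1 * cnj v1 = 1"
    "cmod c \<le> 1" "cmod e \<le> 1"
    "ip d f h = c * u0 * cnj v0 + e * cnj u1 * v1" "ip d f k = c * u0 * cnj v1 - e * cnj u1 * v0"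
    "ip d g h = c * u1 * cnj v0 - e * cnj u0 * v1" "ip d g k = c * u1 * cnj v1 + e * cnj u0 * v0"
    by (rule svd_2x2_contraction[OF contr])
  \<comment> \<open>Coefficients along the rotated vectors: \<open>X\<close> belongs to
    \<open>cnj u0 * f + cnj u1 * g\<close> and \<open>cnj v0 * h + cnj v1 * k\<close>,
    \<open>Y\<close> to \<open>- u1 * f + u0 * g\<close> and
    \<open>- v1 * h + v0 * k\<close>.\<close>
  define X where "X = (\<lambda>i::nat. if i = 0 then a * u0 else if i = 1 then p * v0 else
      if i = 2 then b0 * u0 + b1 * u1 else q0 * v0 + q1 * v1)"
  define Y where "Y = (\<lambda>i::nat. if i = 0 then - a * cnj u1 else if i = 1 then - p * cnj v1 else
      if i = 2 then - b0 * cnj u1 + b1 * cnj u0 else - q0 * cnj v1 + q1 * cnj v0)"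
  have XY [simp]: "X 0 = a * u0" "X 1 = p * v0" "X 2 = b0 * u0 + b1 * u1" "X 3 = q0 * v0 + q1 * v1"
    "X (Suc 0) = p * v0" "Y (Suc 0) = - p * cnj v1"
    "Y 0 = - a * cnj u1" "Y 1 = - p * cnj v1" "Y 2 = - b0 * cnj u1 + b1 * cnj u0"
    "Y 3 = - q0 * cnj v1 + q1 * cnj v0"
    by (simp_all add: X_def Y_def)
  have V01: "ip d (V 0) (V 1) = ip d (\<lambda>c. a * f c) (\<lambda>c. p * h c)"
    using F(1) G(1) by (intro ip_cong) auto
  have V03: "ip d (V 0) (V 3) = ip d (\<lambda>c. a * f c) (\<lambda>c. q0 * h c + q1 * k c)"
    using F(1) G(2) by (intro ip_cong) auto
  have V21: "ip d (V 2) (V 1) = ip d (\<lambda>c. b0 * f c + b1 * g c) (\<lambda>c. p * h c)"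
    using F(2) G(1) by (intro ip_cong) auto
  have V23: "ip d (V 2) (V 3) = ip d (\<lambda>c. b0 * f c + b1 * g c) (\<lambda>c. q0 * h c + q1 * k c)"
    using F(2) G(2) by (intro ip_cong) auto
  show ?thesis
  proof (rule that[OF S(3,4), of X Y])
    fix i j :: nat
    show "ip d (V i) (V j) = X i * cnj (X j) + Y i * cnj (Y j)" if "i \<in> {0, 2}" "j \<in> {0, 2}"
    proof -
      have "ip d (V 0) (V 0) = X 0 * cnj (X 0) + Y 0 * cnj (Y 0)"
        "ip d (V 0) (V 2) = X 0 * cnj (X 2) + Y 0 * cnj (Y 2)"
        "ip d (V 2) (V 0) = X 2 * cnj (X 0) + Y 2 * cnj (Y 0)"
        "ip d (V 2) (V 2) = X 2 * cnj (X 2) + Y 2 * cnj (Y 2)"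
        unfolding F F' XY using S(1)
        by (simp, algebra)+
      then show ?thesis using that by blast
    qed
    show "ip d (V i) (V j) = X i * cnj (X j) + Y i * cnj (Y j)" if "i \<in> {1, 3}" "j \<in> {1, 3}"
    proof -
      have "ip d (V 1) (V 1) = X 1 * cnj (X 1) + Y 1 * cnj (Y 1)"
        "ip d (V 1) (V 3) = X 1 * cnj (X 3) + Y 1 * cnj (Y 3)"
        "ip d (V 3) (V 1) = X 3 * cnj (X 1) + Y 3 * cnj (Y 1)"
        "ip d (V 3) (V 3) = X 3 * cnj (X 3) + Y 3 * cnj (Y 3)"
        unfolding G G' XY using S(2)
        by (simp, algebra)+
      then show ?thesis using that by blast
    qed
    show "ip d (V i) (V j) = c * X i * cnj (X j) + e * Y i * cnj (Y j)" if "i \<in> {0, 2}" "j \<in> {1, 3}"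
    proof -
      have "ip d (V 0) (V 1) = c * X 0 * cnj (X 1) + e * Y 0 * cnj (Y 1)"
        "ip d (V 0) (V 3) = c * X 0 * cnj (X 3) + e * Y 0 * cnj (Y 3)"
        "ip d (V 2) (V 1) = c * X 2 * cnj (X 1) + e * Y 2 * cnj (Y 1)"
        "ip d (V 2) (V 3) = c * X 2 * cnj (X 3) + e * Y 2 * cnj (Y 3)"
        unfolding V01 V03 V21 V23 XY by (simp_all add: ip_linear S(5-8) algebra_simps)
      then show ?thesis using that by blast
    qed
  qed
qed

text \<open>The points of the unit circle with real part \<open>cmod c\<close> have mean
  \<open>cmod c\<close>; rotating them by the phase of \<open>c\<close> moves the mean to
  \<open>c\<close>.\<close>

lemma mean_of_unit_complex:
  assumes "cmod c \<le> 1"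
  obtains z1 z2 where "cmod z1 = 1" "cmod z2 = 1" "c = (z1 + z2) / 2"
proof -
  define t where "t = sqrt (1 - (cmod c)\<^sup>2)"
  have t2: "t\<^sup>2 = 1 - (cmod c)\<^sup>2" using assms by (simp add: t_def abs_square_le_1)
  define s where "s = cis (Arg c)"
  have c: "c = of_real (cmod c) * s" using rcis_cmod_Arg[of c] by (simp add: s_def rcis_def)
  have s: "cmod s = 1" by (simp add: s_def)
  have n: "cmod (Complex (cmod c) t) = 1" "cmod (Complex (cmod c) (- t)) = 1"
    using t2 by (simp_all add: cmod_def)
  show ?thesis
  proof (rule that[of "Complex (cmod c) t * s" "Complex (cmod c) (- t) * s"])
    have "Complex (cmod c) t + Complex (cmod c) (- t) = 2 * of_real (cmod c)"
      by (simp add: complex_eq_iff)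
    then have "Complex (cmod c) t * s + Complex (cmod c) (- t) * s = 2 * (of_real (cmod c) * s)"
      by (metis distrib_right mult.assoc)
    then show "c = (Complex (cmod c) t * s + Complex (cmod c) (- t) * s) / 2" using c by simp
  qed (simp_all add: norm_mult s n)
qed

text \<open>A unitary mixing of \<open>X\<close> and \<open>Y\<close> preserves their Gram matrix
  \<open>G\<close>, and the half concurrences become moduli of the diagonal entries of a rotated
  \<open>N\<close>, one of which can be made zero. The \<open>Re\<close> term is the squared
  Frobenius norm of \<open>N\<close>, and the last two minors multiply to its determinant.\<close>

lemma rank_two_decomposition:
  fixes X Y :: "nat \<Rightarrow> complex"
  defines "G \<equiv> \<lambda>i j. X i * cnj (X j) + Y i * cnj (Y j)"
  obtains \<phi> \<phi>' :: "nat \<Rightarrow> complex" where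
    "\<And>i j. \<phi> i * cnj (\<phi> j) + \<phi>' i * cnj (\<phi>' j) = G i j"
    "(cmod (\<phi> 0 * \<phi> 3 - \<phi> 1 * \<phi> 2) + cmod (\<phi>' 0 * \<phi>' 3 - \<phi>' 1 * \<phi>' 2))\<^sup>2
      \<le> Re (G 0 0 * G 3 3 + G 1 1 * G 2 2 - G 0 2 * G 3 1 - G 2 0 * G 1 3)
        - 2 * (cmod (X 0 * Y 2 - X 2 * Y 0) * cmod (X 1 * Y 3 - X 3 * Y 1))"
proof -
  let ?n00 = "X 0 * X 3 - X 2 * X 1" and ?n01 = "X 0 * Y 3 - X 2 * Y 1"
    and ?n10 = "Y 0 * X 3 - Y 2 * X 1" and ?n11 = "Y 0 * Y 3 - Y 2 * Y 1"
  obtain w0 w1 where w: "w0 * cnj w0 + w1 * cnj w1 = 1"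
    "?n00 * w0 * w0 + ?n01 * w0 * w1 + ?n10 * w1 * w0 + ?n11 * w1 * w1 = 0"
    "(cmod (?n00 * cnj w1 * cnj w1 - ?n01 * cnj w1 * cnj w0 - ?n10 * cnj w0 * cnj w1 + ?n11 * cnj w0 * cnj w0))\<^sup>2
      \<le> (cmod ?n00)\<^sup>2 + (cmod ?n01)\<^sup>2 + (cmod ?n10)\<^sup>2 + (cmod ?n11)\<^sup>2 - 2 * cmod (?n00 * ?n11 - ?n01 * ?n10)"
    by (rule rotate_to_zero_diagonal)
  define \<phi> where "\<phi> = (\<lambda>i. w0 * X i + w1 * Y i)"
  define \<phi>' where "\<phi>' = (\<lambda>i. - cnj w1 * X i + cnj w0 * Y i)"
  have gram: "\<phi> i * cnj (\<phi> j) + \<phi>' i * cnj (\<phi>' j) = G i j" for i j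
    unfolding \<phi>_def \<phi>'_def G_def using w(1) by simp algebra
  have 1: "\<phi> 0 * \<phi> 3 - \<phi> 1 * \<phi> 2 = 0"
    unfolding \<phi>_def w(2)[symmetric] by (simp add: algebra_simps)
  have 2: "\<phi>' 0 * \<phi>' 3 - \<phi>' 1 * \<phi>' 2
      = ?n00 * cnj w1 * cnj w1 - ?n01 * cnj w1 * cnj w0 - ?n10 * cnj w0 * cnj w1 + ?n11 * cnj w0 * cnj w0"
    unfolding \<phi>'_def by (simp add: algebra_simps)
  have 3: "?n00 * ?n11 - ?n01 * ?n10 = (X 0 * Y 2 - X 2 * Y 0) * (X 1 * Y 3 - X 3 * Y 1)"
    by algebra
  have "complex_of_real ((cmod ?n00)\<^sup>2 + (cmod ?n01)\<^sup>2 + (cmod ?n10)\<^sup>2 + (cmod ?n11)\<^sup>2)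
      = G 0 0 * G 3 3 + G 1 1 * G 2 2 - G 0 2 * G 3 1 - G 2 0 * G 1 3"
    unfolding of_real_add complex_norm_square G_def by (simp add: algebra_simps)
  then have 4: "(cmod ?n00)\<^sup>2 + (cmod ?n01)\<^sup>2 + (cmod ?n10)\<^sup>2 + (cmod ?n11)\<^sup>2
      = Re (G 0 0 * G 3 3 + G 1 1 * G 2 2 - G 0 2 * G 3 1 - G 2 0 * G 1 3)"
    by (metis Re_complex_of_real)
  show ?thesis
    using w(3) by (intro that[OF gram]) (simp only: 1 2 3 4 norm_zero add_0_left norm_mult)
qed

text \<open>Lagrange's identity. The hypotheses speak of inner products only, so the coordinates may
  be principal ones instead of entries of \<open>x\<close> and \<open>y\<close>.\<close>

lemma gramdet_two_coordinates:
  assumes "ip d x x = x0 * cnj x0 + x1 * cnj x1" "ip d x y = x0 * cnj y0 + x1 * cnj y1"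
    "ip d y y = y0 * cnj y0 + y1 * cnj y1"
  shows "gramdet d x y = (cmod (x0 * y1 - y0 * x1))\<^sup>2"
proof -
  have "complex_of_real (gramdet d x y) = ip d x x * ip d y y - ip d x y * cnj (ip d x y)"
    unfolding gramdet_def of_real_diff of_real_mult ip_self complex_norm_square ..
  also have "\<dots> = (x0 * y1 - y0 * x1) * cnj (x0 * y1 - y0 * x1)"
    unfolding assms by (simp add: algebra_simps)
  also have "\<dots> = of_real ((cmod (x0 * y1 - y0 * x1))\<^sup>2)"
    by (rule complex_norm_square[symmetric])
  finally show ?thesis by (simp only: of_real_eq_iff)
qed

text \<open>Writing the entries of the contraction between the principal coordinates as means of two
  phases makes the Gram matrix the mean of two Gram matrices of rank two with the same
  diagonal blocks.\<close>

lemma gram_decomposition: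
  fixes V :: "nat \<Rightarrow> nat \<Rightarrow> complex" and d :: nat
  defines "g \<equiv> \<lambda>i j. ip d (V i) (V j)"
  obtains L :: "(nat \<Rightarrow> complex) list" where
    "\<And>i j. i < 4 \<Longrightarrow> j < 4 \<Longrightarrow> g i j = (\<Sum>v\<leftarrow>L. v i * cnj (v j))"
    "(\<Sum>v\<leftarrow>L. cmod (v 0 * v 3 - v 1 * v 2))\<^sup>2
      \<le> Re (g 0 0 * g 3 3 + g 1 1 * g 2 2 - g 0 2 * g 3 1 - g 2 0 * g 1 3)
        - 2 * sqrt (gramdet d (V 0) (V 2)) * sqrt (gramdet d (V 1) (V 3))"
proof -
  obtain X Y c e where ce: "cmod c \<le> 1" "cmod e \<le> 1"
    and even: "\<And>i j. i \<in> {0, 2} \<Longrightarrow> j \<in> {0, 2} \<Longrightarrow> ip d (V i) (V j) = X i * cnj (X j) + Y i * cnj (Y j)"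
    and odd: "\<And>i j. i \<in> {1, 3} \<Longrightarrow> j \<in> {1, 3} \<Longrightarrow> ip d (V i) (V j) = X i * cnj (X j) + Y i * cnj (Y j)"
    and cross: "\<And>i j. i \<in> {0, 2} \<Longrightarrow> j \<in> {1, 3} \<Longrightarrow> ip d (V i) (V j) = c * X i * cnj (X j) + e * Y i * cnj (Y j)"
    by (rule principal_coordinates[of d V]) (rule that)
  have cross': "ip d (V i) (V j) = cnj c * X i * cnj (X j) + cnj e * Y i * cnj (Y j)"
    if "i \<in> {1, 3}" "j \<in> {0, 2}" for i j
    using arg_cong[OF cross[OF that(2,1)], of cnj] by (simp add: ip_cnj mult_ac)
  obtain c1 c2 where c: "cmod c1 = 1" "cmod c2 = 1" "c = (c1 + c2) / 2"
    by (rule mean_of_unit_complex[OF ce(1)])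
  obtain e1 e2 where e: "cmod e1 = 1" "cmod e2 = 1" "e = (e1 + e2) / 2"
    by (rule mean_of_unit_complex[OF ce(2)])
  define K where "K = Re (g 0 0 * g 3 3 + g 1 1 * g 2 2 - g 0 2 * g 3 1 - g 2 0 * g 1 3)
        - 2 * sqrt (gramdet d (V 0) (V 2)) * sqrt (gramdet d (V 1) (V 3))"
  have A: "sqrt (gramdet d (V 0) (V 2)) = cmod (X 0 * Y 2 - X 2 * Y 0)"
    by (subst gramdet_two_coordinates[of _ _ "X 0" "Y 0" _ "X 2" "Y 2"]) (auto intro!: even)
  have B: "sqrt (gramdet d (V 1) (V 3)) = cmod (X 1 * Y 3 - X 3 * Y 1)"
    by (subst gramdet_two_coordinates[of _ _ "X 1" "Y 1" _ "X 3" "Y 3"]) (auto intro!: odd)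
  \<comment> \<open>The phases sit on the coordinates of odd index and change only the blocks
    pairing even with odd. \<open>K\<close> is built from the diagonal blocks, so it serves for all
    phases.\<close>
  have phase: "\<exists>\<phi> \<phi>'. (\<forall>i j. \<phi> i * cnj (\<phi> j) + \<phi>' i * cnj (\<phi>' j)
        = (if even i then 1 else cnj z) * X i * cnj ((if even j then 1 else cnj z) * X j)
        + (if even i then 1 else cnj y) * Y i * cnj ((if even j then 1 else cnj y) * Y j))
      \<and> cmod (\<phi> 0 * \<phi> 3 - \<phi> 1 * \<phi> 2) + cmod (\<phi>' 0 * \<phi>' 3 - \<phi>' 1 * \<phi>' 2) \<le> sqrt K"
    if z: "cmod z = 1" and y: "cmod y = 1" for z y
  proof -
    have zz: "z * cnj z = 1" "y * cnj y = 1" using z y complex_norm_square[of z] complex_norm_square[of y]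
      by simp_all
    define X' where "X' = (\<lambda>i. (if even i then 1 else cnj z) * X i)"
    define Y' where "Y' = (\<lambda>i. (if even i then 1 else cnj y) * Y i)"
    define G where "G = (\<lambda>i j. X' i * cnj (X' j) + Y' i * cnj (Y' j))"
    obtain \<phi> \<phi>' where \<phi>: "\<And>i j. \<phi> i * cnj (\<phi> j) + \<phi>' i * cnj (\<phi>' j) = G i j"
      "(cmod (\<phi> 0 * \<phi> 3 - \<phi> 1 * \<phi> 2) + cmod (\<phi>' 0 * \<phi>' 3 - \<phi>' 1 * \<phi>' 2))\<^sup>2
      \<le> Re (G 0 0 * G 3 3 + G 1 1 * G 2 2 - G 0 2 * G 3 1 - G 2 0 * G 1 3)
        - 2 * (cmod (X' 0 * Y' 2 - X' 2 * Y' 0) * cmod (X' 1 * Y' 3 - X' 3 * Y' 1))"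
      by (rule rank_two_decomposition[of X' Y']) (rule that, simp_all only: G_def)
    have "G i j = g i j" if "i \<in> {0, 2} \<and> j \<in> {0, 2} \<or> i \<in> {1, 3} \<and> j \<in> {1, 3}" for i j
    proof -
      have "g i j = X i * cnj (X j) + Y i * cnj (Y j)" using that even odd by (auto simp: g_def)
      moreover have "G i j = X i * cnj (X j) + Y i * cnj (Y j)"
      proof (cases "even i")
        case True
        then have "even j" using that by auto
        with True show ?thesis by (simp add: G_def X'_def Y'_def)
      next
        case False
        then have "odd j" using that by auto
        with False have "G i j = (z * cnj z) * X i * cnj (X j) + (y * cnj y) * Y i * cnj (Y j)"
          by (simp add: G_def X'_def Y'_def mult_ac)
        then show ?thesis by (simp add: zz)
      qed
      ultimately show ?thesis by simp
    qed
    then have "Re (G 0 0 * G 3 3 + G 1 1 * G 2 2 - G 0 2 * G 3 1 - G 2 0 * G 1 3)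
        = Re (g 0 0 * g 3 3 + g 1 1 * g 2 2 - g 0 2 * g 3 1 - g 2 0 * g 1 3)" by simp
    moreover have "X' 0 * Y' 2 - X' 2 * Y' 0 = X 0 * Y 2 - X 2 * Y 0" by (simp add: X'_def Y'_def)
    moreover have "X' 1 * Y' 3 - X' 3 * Y' 1 = cnj z * cnj y * (X 1 * Y 3 - X 3 * Y 1)"
      by (simp add: X'_def Y'_def algebra_simps)
    ultimately have "(cmod (\<phi> 0 * \<phi> 3 - \<phi> 1 * \<phi> 2) + cmod (\<phi>' 0 * \<phi>' 3 - \<phi>' 1 * \<phi>' 2))\<^sup>2 \<le> K"
      using \<phi>(2) by (simp only: K_def A B norm_mult complex_mod_cnj z y mult_1_left mult.assoc)
    then have "cmod (\<phi> 0 * \<phi> 3 - \<phi> 1 * \<phi> 2) + cmod (\<phi>' 0 * \<phi>' 3 - \<phi>' 1 * \<phi>' 2) \<le> sqrt K"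
      by (rule real_le_rsqrt)
    then show ?thesis using \<phi>(1) unfolding G_def X'_def Y'_def by blast
  qed
  obtain \<phi>1 \<phi>1' where \<phi>1: "\<And>i j. \<phi>1 i * cnj (\<phi>1 j) + \<phi>1' i * cnj (\<phi>1' j)
        = (if even i then 1 else cnj c1) * X i * cnj ((if even j then 1 else cnj c1) * X j)
        + (if even i then 1 else cnj e1) * Y i * cnj ((if even j then 1 else cnj e1) * Y j)"
      "cmod (\<phi>1 0 * \<phi>1 3 - \<phi>1 1 * \<phi>1 2) + cmod (\<phi>1' 0 * \<phi>1' 3 - \<phi>1' 1 * \<phi>1' 2) \<le> sqrt K"
    using phase[OF c(1) e(1)] by blast
  obtain \<phi>2 \<phi>2' where \<phi>2: "\<And>i j. \<phi>2 i * cnj (\<phi>2 j) + \<phi>2' i * cnj (\<phi>2' j)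
        = (if even i then 1 else cnj c2) * X i * cnj ((if even j then 1 else cnj c2) * X j)
        + (if even i then 1 else cnj e2) * Y i * cnj ((if even j then 1 else cnj e2) * Y j)"
      "cmod (\<phi>2 0 * \<phi>2 3 - \<phi>2 1 * \<phi>2 2) + cmod (\<phi>2' 0 * \<phi>2' 3 - \<phi>2' 1 * \<phi>2' 2) \<le> sqrt K"
    using phase[OF c(2) e(2)] by blast
  \<comment> \<open>This scaling turns the sum of the two Gram matrices into their mean; the costs,
    quadratic in the vectors, are averaged too.\<close>
  define h where "h = complex_of_real (1 / sqrt 2)"
  have hh: "h * h = 1 / 2" by (simp add: h_def flip: of_real_mult)
  have cnjh: "cnj h = h" by (simp add: h_def)
  define L where "L = map (\<lambda>\<phi> i. h * \<phi> i) [\<phi>1, \<phi>1', \<phi>2, \<phi>2']"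
  have unit: "cnj w * a * (w * b) = a * b" if "cmod w = 1" for w a b
  proof -
    have "w * cnj w = 1" using that complex_norm_square[of w] by simp
    then show ?thesis by algebra
  qed
  have cases4: "m \<in> {0, 2} \<and> even m \<or> m \<in> {1, 3} \<and> odd m" if "m < 4" for m :: nat
  proof -
    have "m = 0 \<or> m = 1 \<or> m = 2 \<or> m = 3" using that by linarith
    then show ?thesis by auto
  qed
  have "g i j = (\<Sum>v\<leftarrow>L. v i * cnj (v j))" if ij: "i < 4" "j < 4" for i j
  proof -
    have "(\<Sum>v\<leftarrow>L. v i * cnj (v j)) = h * h * ((\<phi>1 i * cnj (\<phi>1 j) + \<phi>1' i * cnj (\<phi>1' j))
        + (\<phi>2 i * cnj (\<phi>2 j) + \<phi>2' i * cnj (\<phi>2' j)))"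
      by (simp add: L_def cnjh algebra_simps)
    then have sum: "(\<Sum>v\<leftarrow>L. v i * cnj (v j)) =
        ((if even i then 1 else cnj c1) * X i * cnj ((if even j then 1 else cnj c1) * X j)
        + (if even i then 1 else cnj e1) * Y i * cnj ((if even j then 1 else cnj e1) * Y j)
        + ((if even i then 1 else cnj c2) * X i * cnj ((if even j then 1 else cnj c2) * X j)
        + (if even i then 1 else cnj e2) * Y i * cnj ((if even j then 1 else cnj e2) * Y j))) / 2"
      unfolding \<phi>1(1) \<phi>2(1) hh by simp
    consider "i \<in> {0, 2}" "even i" "j \<in> {0, 2}" "even j" | "i \<in> {1, 3}" "odd i" "j \<in> {1, 3}" "odd j"
      | "i \<in> {0, 2}" "even i" "j \<in> {1, 3}" "odd j" | "i \<in> {1, 3}" "odd i" "j \<in> {0, 2}" "even j"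
      using cases4[OF ij(1)] cases4[OF ij(2)] by blast
    then show ?thesis
    proof cases
      case 1
      show ?thesis unfolding sum g_def even[OF 1(1,3)] using 1(2,4) by simp
    next
      case 2
      show ?thesis unfolding sum g_def odd[OF 2(1,3)] using 2(2,4) by (simp add: unit c(1,2) e(1,2))
    next
      case 3
      show ?thesis unfolding sum g_def cross[OF 3(1,3)] c(3) e(3) using 3(2,4) by (simp add: field_simps)
    next
      case 4
      show ?thesis unfolding sum g_def cross'[OF 4(1,3)] c(3) e(3) using 4(2,4) by (simp add: field_simps)
    qed
  qed
  moreover have "(\<Sum>v\<leftarrow>L. cmod (v 0 * v 3 - v 1 * v 2))\<^sup>2 \<le> K"
  proof -
    have half: "cmod (h * \<phi> 0 * (h * \<phi> 3) - h * \<phi> 1 * (h * \<phi> 2)) = cmod (\<phi> 0 * \<phi> 3 - \<phi> 1 * \<phi> 2) / 2"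
      for \<phi> :: "nat \<Rightarrow> complex"
    proof -
      have "h * \<phi> 0 * (h * \<phi> 3) - h * \<phi> 1 * (h * \<phi> 2) = (h * h) * (\<phi> 0 * \<phi> 3 - \<phi> 1 * \<phi> 2)"
        by (simp add: algebra_simps)
      then show ?thesis by (simp only: hh norm_mult norm_divide norm_one norm_numeral)
    qed
    have "(\<Sum>v\<leftarrow>L. cmod (v 0 * v 3 - v 1 * v 2)) \<le> sqrt K"
      using \<phi>1(2) \<phi>2(2) unfolding L_def list.map sum_list.Cons sum_list.Nil half by linarith
    \<comment> \<open>Lying above a nonnegative sum, \<open>sqrt K\<close> is nonnegative; hence so
      is \<open>K\<close>, and squaring recovers it.\<close>
    moreover have "0 \<le> (\<Sum>v\<leftarrow>L. cmod (v 0 * v 3 - v 1 * v 2))" by (simp add: L_def)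
    ultimately have "(\<Sum>v\<leftarrow>L. cmod (v 0 * v 3 - v 1 * v 2))\<^sup>2 \<le> (sqrt K)\<^sup>2" "0 \<le> sqrt K"
      by (blast intro: power_mono order_trans)+
    then show ?thesis by simp
  qed
  ultimately show ?thesis using that by (simp add: K_def)
qed

section \<open>Unnormalised ensembles\<close>

text \<open>\<open>ucost\<close> is the concurrence of a vector that need not be normalised; being homogeneous of degree
  two, it absorbs the probabilities of an ensemble into the vectors.\<close>

definition ucost :: "nat \<Rightarrow> (nat \<Rightarrow> complex) \<Rightarrow> real" where
  "ucost d \<phi> = 2 * sqrt (gramdet d \<phi> (\<lambda>b. \<phi> (d + b)))"

definition decomposes :: "nat \<Rightarrow> (nat \<Rightarrow> nat \<Rightarrow> complex) \<Rightarrow> (nat \<Rightarrow> complex) list \<Rightarrow> bool" where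
  "decomposes N \<rho> L \<longleftrightarrow> (\<forall>i<N. \<forall>j<N. \<rho> i j = (\<Sum>v\<leftarrow>L. v i * cnj (v j)))"

lemma ucost_nonneg: "0 \<le> ucost d \<phi>"
  by (simp add: ucost_def gramdet_nonneg)

text \<open>The determinant formula for the concurrence of two qubits.\<close>

lemma ucost_2: "ucost 2 \<phi> = 2 * cmod (\<phi> 0 * \<phi> 3 - \<phi> 1 * \<phi> 2)"
proof -
  have "gramdet 2 \<phi> (\<lambda>b. \<phi> (2 + b)) = (cmod (\<phi> 0 * \<phi> 3 - \<phi> 2 * \<phi> 1))\<^sup>2"
    by (rule gramdet_two_coordinates) (simp_all add: ip_def numeral_2_eq_2 numeral_3_eq_3)
  then show ?thesis by (simp add: ucost_def mult.commute)
qed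

lemma ucost_cmul: "ucost d (\<lambda>i. a * \<phi> i) = (cmod a)\<^sup>2 * ucost d \<phi>"
proof -
  have "gramdet d (\<lambda>i. a * \<phi> i) (\<lambda>b. a * \<phi> (d + b)) = ((cmod a)\<^sup>2)\<^sup>2 * gramdet d \<phi> (\<lambda>b. \<phi> (d + b))"
    by (simp add: gramdet_def nsq_cmul ip_linear norm_mult power_mult_distrib power2_eq_square algebra_simps)
  then show ?thesis
    by (simp only: ucost_def real_sqrt_mult real_sqrt_abs abs_power2 mult.left_commute)
qed

text \<open>Splits the indices of a qubit tensored with a \<open>d\<close>-dimensional space by the
  basis vector of the qubit.\<close>

lemma sum_double:
  fixes f :: "nat \<Rightarrow> 'a::comm_monoid_add"
  shows "(\<Sum>i<2 * d. f i) = (\<Sum>c<d. f c) + (\<Sum>c<d. f (d + c))"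
proof -
  have "(\<Sum>i<2 * d. f i) = (\<Sum>i<d. f i) + (\<Sum>i\<in>{d..<2 * d}. f i)"
    by (subst sum.union_disjoint[symmetric]) (auto intro: sum.cong)
  also have "(\<Sum>i\<in>{d..<2 * d}. f i) = (\<Sum>c<d. f (d + c))"
    using sum.shift_bounds_nat_ivl[of f 0 d d] by (simp add: atLeast0LessThan add.commute mult_2)
  finally show ?thesis .
qed

lemma nsq_double: "nsq (2 * d) \<phi> = nsq d \<phi> + nsq d (\<lambda>b. \<phi> (d + b))"
  by (simp add: nsq_def sum_double)

text \<open>A 2x2 matrix of trace one satisfies \<open>1 - tr(\<rho>^2) = 2 det \<rho>\<close>, and
  the determinant of the reduced state is the Gram determinant of the two blocks.\<close>

lemma conc_pure_eq_ucost:
  assumes "unit_vec (2 * d) \<phi>"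
  shows "conc_pure 2 d \<phi> = ucost d \<phi>"
proof -
  let ?x = "nsq d \<phi>" and ?y = "nsq d (\<lambda>b. \<phi> (d + b))" and ?z = "ip d \<phi> (\<lambda>b. \<phi> (d + b))"
  have sum1: "?x + ?y = 1"
    using assms by (simp add: unit_vec_def nsq_def sum_double)
  have r: "reduced_pure d \<phi> 0 0 = of_real ?x" "reduced_pure d \<phi> 0 1 = ?z"
    "reduced_pure d \<phi> 1 0 = cnj ?z" "reduced_pure d \<phi> 1 1 = of_real ?y"
    by (simp_all add: reduced_pure_def ip_self[symmetric] ip_cnj) (simp_all add: ip_def)
  have "(\<Sum>i<2. \<Sum>j<2. reduced_pure d \<phi> i j * reduced_pure d \<phi> j i)
      = of_real (?x * ?x + ?y * ?y + 2 * (cmod ?z)\<^sup>2)"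
    unfolding of_real_add of_real_mult complex_norm_square
    using r by (simp add: numeral_2_eq_2 algebra_simps)
  then have "2 * (1 - Re (\<Sum>i<2. \<Sum>j<2. reduced_pure d \<phi> i j * reduced_pure d \<phi> j i))
      = 2 * ((?x + ?y)\<^sup>2 - (?x * ?x + ?y * ?y + 2 * (cmod ?z)\<^sup>2))"
    using sum1 by (simp only: Re_complex_of_real power_one)
  also have "\<dots> = 2\<^sup>2 * gramdet d \<phi> (\<lambda>b. \<phi> (d + b))"
    by (simp add: gramdet_def power2_eq_square algebra_simps)
  finally show ?thesis
    by (simp add: conc_pure_def ucost_def real_sqrt_mult)
qed

lemma ensemble_cost_nonneg:
  assumes "is_ensemble (2 * d) \<rho> E"
  shows "0 \<le> (\<Sum>(p, \<phi>)\<leftarrow>E. p * conc_pure 2 d \<phi>)"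
  using assms unfolding is_ensemble_def
  by (intro sum_list_nonneg) (auto simp: conc_pure_eq_ucost ucost_nonneg)

text \<open>The given ensemble makes the set nonempty; \<open>Inf\<close> of the empty set would be
  unspecified.\<close>

lemma conc_nonneg:
  assumes "is_ensemble (2 * d) \<rho> E"
  shows "0 \<le> conc 2 d \<rho>"
  unfolding conc_def using assms ensemble_cost_nonneg by (intro cInf_greatest) auto

lemma ucost_eq_0_of_nsq: "nsq (2 * d) v = 0 \<Longrightarrow> ucost d v = 0"
  using nsq_nonneg[of d v] nsq_nonneg[of d "\<lambda>b. v (d + b)"]
  by (auto simp: ucost_def gramdet_def nsq_double add_nonneg_eq_0_iff nsq_eq_0_iff ip_def)

text \<open>Squared norms become probabilities, and the trace condition makes them sum to one.
  Vectors of norm zero cannot be normalised and are dropped; they contribute neither to the matrix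
  nor to the cost.\<close>

lemma decomposes_imp_ensemble:
  assumes tr: "(\<Sum>i<2 * d. \<rho> i i) = 1" and dec: "decomposes (2 * d) \<rho> L"
  obtains E where "is_ensemble (2 * d) \<rho> E"
    "(\<Sum>(p, \<phi>)\<leftarrow>E. p * conc_pure 2 d \<phi>) = (\<Sum>v\<leftarrow>L. ucost d v)"
proof -
  let ?N = "2 * d"
  define F where "F = (\<lambda>v. (nsq ?N v, nrm ?N v))"
  define E where "E = map F (filter (\<lambda>v. nsq ?N v \<noteq> 0) L)"
  have unit: "unit_vec ?N (nrm ?N v)" if "nsq ?N v \<noteq> 0" for v
    using that nsq_nrm[of ?N v] by (simp add: unit_vec_def nsq_def)
  have zero: "v i = 0" if "nsq ?N v = 0" "i < ?N" for v i
    using that by (auto simp: nsq_eq_0_iff)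
  have dec': "\<rho> i j = (\<Sum>(p, \<phi>)\<leftarrow>E. of_real p * \<phi> i * cnj (\<phi> j))" if "i < ?N" "j < ?N" for i j
  proof -
    have "(case F v of (p, \<phi>) \<Rightarrow> of_real p * \<phi> i * cnj (\<phi> j)) = v i * cnj (v j)" for v
    proof -
      have "complex_of_real (nsq ?N v) = of_real (sqrt (nsq ?N v)) * of_real (sqrt (nsq ?N v))"
        by (simp flip: of_real_mult)
      then show ?thesis
        using nrm_scale[OF that(1), of v] nrm_scale[OF that(2), of v]
        by (simp add: F_def)
    qed
    then have "(\<Sum>(p, \<phi>)\<leftarrow>E. of_real p * \<phi> i * cnj (\<phi> j))
        = (\<Sum>v\<leftarrow>filter (\<lambda>v. nsq ?N v \<noteq> 0) L. v i * cnj (v j))"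
      by (simp add: E_def o_def)
    also have "\<dots> = (\<Sum>v\<leftarrow>L. v i * cnj (v j))"
      by (rule sum_list_map_filter) (use zero that in auto)
    finally show ?thesis using dec that by (simp add: decomposes_def)
  qed
  have "sum_list (map fst E) = (\<Sum>v\<leftarrow>filter (\<lambda>v. nsq ?N v \<noteq> 0) L. nsq ?N v)"
    by (simp add: E_def F_def o_def)
  also have "\<dots> = (\<Sum>v\<leftarrow>L. nsq ?N v)"
    by (rule sum_list_map_filter) auto
  finally have fstE: "sum_list (map fst E) = (\<Sum>v\<leftarrow>L. nsq ?N v)" .
  have "complex_of_real (\<Sum>v\<leftarrow>L. nsq ?N v) = (\<Sum>v\<leftarrow>L. ip ?N v v)"
    by (induction L) (simp_all add: ip_self)
  also have "\<dots> = (\<Sum>i<?N. \<Sum>v\<leftarrow>L. v i * cnj (v i))"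
    by (induction L) (simp_all add: ip_def sum.distrib)
  also have "\<dots> = (\<Sum>i<?N. \<rho> i i)"
    using dec by (intro sum.cong) (auto simp: decomposes_def)
  also have "\<dots> = of_real 1" using tr by simp
  finally have "(\<Sum>v\<leftarrow>L. nsq ?N v) = 1" by (simp only: of_real_eq_iff)
  then have ens: "is_ensemble ?N \<rho> E"
    unfolding is_ensemble_def using fstE dec' unit by (auto simp: E_def F_def)
  have cost: "nsq ?N v * conc_pure 2 d (nrm ?N v) = ucost d v" if "nsq ?N v \<noteq> 0" for v
  proof -
    have "ucost d (nrm ?N v) = (inverse (sqrt (nsq ?N v)))\<^sup>2 * ucost d v"
      unfolding nrm_def ucost_cmul norm_of_real power2_abs ..
    then show ?thesis using that
      by (simp add: conc_pure_eq_ucost[OF unit[OF that]] power_inverse)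
  qed
  have "(\<Sum>(p, \<phi>)\<leftarrow>E. p * conc_pure 2 d \<phi>)
      = (\<Sum>v\<leftarrow>filter (\<lambda>v. nsq ?N v \<noteq> 0) L. nsq ?N v * conc_pure 2 d (nrm ?N v))"
    by (simp add: E_def F_def o_def)
  also have "\<dots> = (\<Sum>v\<leftarrow>filter (\<lambda>v. nsq ?N v \<noteq> 0) L. ucost d v)"
    by (intro arg_cong[where f = sum_list] map_cong) (auto simp: cost)
  also have "\<dots> = (\<Sum>v\<leftarrow>L. ucost d v)"
    by (rule sum_list_map_filter) (auto simp: ucost_eq_0_of_nsq)
  finally show ?thesis using that ens by blast
qed

lemma conc_le:
  assumes "(\<Sum>i<2 * d. \<rho> i i) = 1" and "decomposes (2 * d) \<rho> L"
  shows "0 \<le> conc 2 d \<rho>" and "conc 2 d \<rho> \<le> (\<Sum>v\<leftarrow>L. ucost d v)"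
proof -
  obtain E where E: "is_ensemble (2 * d) \<rho> E"
    "(\<Sum>(p, \<phi>)\<leftarrow>E. p * conc_pure 2 d \<phi>) = (\<Sum>v\<leftarrow>L. ucost d v)"
    by (rule decomposes_imp_ensemble[OF assms])
  show "0 \<le> conc 2 d \<rho>" using E(1) by (rule conc_nonneg)
  have "bdd_below {(\<Sum>(p, \<phi>)\<leftarrow>E. p * conc_pure 2 d \<phi>) | E. is_ensemble (2 * d) \<rho> E}"
    by (rule bdd_belowI[of _ 0]) (auto dest: ensemble_cost_nonneg)
  then show "conc 2 d \<rho> \<le> (\<Sum>v\<leftarrow>L. ucost d v)"
    unfolding conc_def unfolding E(2)[symmetric] using E(1) by (intro cInf_lower) auto
qed

lemma ensemble_imp_decomposes:
  assumes "is_ensemble (2 * d) \<rho> E"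
  obtains L where "decomposes (2 * d) \<rho> L"
    "(\<Sum>v\<leftarrow>L. ucost d v) = (\<Sum>(p, \<phi>)\<leftarrow>E. p * conc_pure 2 d \<phi>)"
proof
  let ?f = "\<lambda>(p, \<phi>) i. complex_of_real (sqrt p) * \<phi> i"
  have E: "0 \<le> p \<and> unit_vec (2 * d) \<phi>" if "(p, \<phi>) \<in> set E" for p \<phi>
    using assms that by (auto simp: is_ensemble_def)
  show "decomposes (2 * d) \<rho> (map ?f E)"
    unfolding decomposes_def
  proof (intro allI impI)
    fix i j assume ij: "i < 2 * d" "j < 2 * d"
    have "?f x i * cnj (?f x j) = (case x of (p, \<phi>) \<Rightarrow> of_real p * \<phi> i * cnj (\<phi> j))" if "x \<in> set E" for x
    proof (cases x)
      case (Pair p \<phi>)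
      then have "0 \<le> p" using E that by auto
      then have "complex_of_real (sqrt p) * of_real (sqrt p) = of_real p"
        by (simp flip: of_real_mult)
      then show ?thesis using Pair by (simp add: mult_ac)
    qed
    then have "(\<Sum>v\<leftarrow>map ?f E. v i * cnj (v j)) = (\<Sum>(p, \<phi>)\<leftarrow>E. of_real p * \<phi> i * cnj (\<phi> j))"
      unfolding map_map o_def by (intro arg_cong[where f = sum_list] map_cong) auto
    then show "\<rho> i j = (\<Sum>v\<leftarrow>map ?f E. v i * cnj (v j))"
      using assms ij by (simp add: is_ensemble_def)
  qed
  have "ucost d (?f x) = (case x of (p, \<phi>) \<Rightarrow> p * conc_pure 2 d \<phi>)" if "x \<in> set E" for x
  proof (cases x)
    case (Pair p \<phi>)
    then have "0 \<le> p" "unit_vec (2 * d) \<phi>" using E that by auto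
    then show ?thesis using Pair by (simp add: ucost_cmul conc_pure_eq_ucost)
  qed
  then show "(\<Sum>v\<leftarrow>map ?f E. ucost d v) = (\<Sum>(p, \<phi>)\<leftarrow>E. p * conc_pure 2 d \<phi>)"
    unfolding map_map o_def by (intro arg_cong[where f = sum_list] map_cong) auto
qed

section \<open>Decomposition of positive semidefinite matrices\<close>

text \<open>One step of the Cholesky factorisation: the Schur complement of the last diagonal entry is
  again positive semidefinite. If that entry vanishes, division by zero makes the complement the
  matrix itself.\<close>

lemma psd_decomposes:
  assumes "\<And>i j. i < N \<Longrightarrow> j < N \<Longrightarrow> \<rho> j i = cnj (\<rho> i j)"
    and "\<And>v :: nat \<Rightarrow> complex. 0 \<le> Re (\<Sum>i<N. \<Sum>j<N. cnj (v i) * \<rho> i j * v j)"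
  shows "\<exists>L. decomposes N \<rho> L"
  using assms
proof (induction N arbitrary: \<rho>)
  case 0
  then show ?case by (simp add: decomposes_def)
next
  case (Suc n)
  note herm = Suc.prems(1) and psd = Suc.prems(2)
  have nn_real: "\<rho> n n = of_real (Re (\<rho> n n))"
    using herm[of n n] by (simp add: complex_eq_iff)
  have quad: "(\<Sum>i<Suc n. \<Sum>j<Suc n. cnj (v i) * \<rho> i j * v j)
      = (\<Sum>i<n. \<Sum>j<n. cnj (v i) * \<rho> i j * v j) + (\<Sum>i<n. cnj (v i) * \<rho> i n) * v n
        + cnj (v n) * (\<Sum>j<n. \<rho> n j * v j) + cnj (v n) * \<rho> n n * v n" for v
    by (simp add: sum.distrib sum_distrib_left sum_distrib_right algebra_simps)
  have nn_nonneg: "0 \<le> Re (\<rho> n n)"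
    using psd[of "\<lambda>i. if i = n then 1 else 0"] unfolding quad by simp
  \<comment> \<open>A vanishing diagonal entry kills its column: otherwise \<open>t\<close> can be
    chosen so that the form takes the value -1 at \<open>?v\<close>.\<close>
  have col0: "\<rho> k n = 0" if k: "k < n" and z: "\<rho> n n = 0" for k
  proof (rule ccontr)
    assume nz: "\<rho> k n \<noteq> 0"
    define t where "t = (Re (\<rho> k k) + 1) / (2 * (cmod (\<rho> k n))\<^sup>2)"
    define w where "w = - complex_of_real t * cnj (\<rho> k n)"
    let ?v = "\<lambda>i. if i = n then w else if i = k then 1 else 0"
    have n1: "(\<Sum>i<n. cnj (?v i) * \<rho> i n) = \<rho> k n"
      using k by (subst sum.remove[of _ k]) (auto intro!: sum.neutral)
    have n2: "(\<Sum>j<n. \<rho> n j * ?v j) = \<rho> n k"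
      using k by (subst sum.remove[of _ k]) (auto intro!: sum.neutral)
    have "(\<Sum>i<n. \<Sum>j<n. cnj (?v i) * \<rho> i j * ?v j) = (\<Sum>i<n. cnj (?v i) * \<rho> i k)"
      using k by (intro sum.cong refl, subst sum.remove[of _ k]) (auto intro!: sum.neutral)
    also have "\<dots> = \<rho> k k"
      using k by (subst sum.remove[of _ k]) (auto intro!: sum.neutral)
    finally have n3: "(\<Sum>i<n. \<Sum>j<n. cnj (?v i) * \<rho> i j * ?v j) = \<rho> k k" .
    have "0 \<le> Re (\<rho> k k + \<rho> k n * w + cnj w * \<rho> n k)"
      using psd[of ?v] unfolding quad n1 n2 n3 by (simp add: z)
    also have "\<rho> n k = cnj (\<rho> k n)" using herm[of k n] k by simp
    also have "Re (\<rho> k k + \<rho> k n * w + cnj w * cnj (\<rho> k n)) = Re (\<rho> k k) - 2 * t * (cmod (\<rho> k n))\<^sup>2"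
      unfolding cmod_power2 by (simp add: w_def power2_eq_square algebra_simps)
    also have "\<dots> = - 1" using nz by (simp add: t_def field_simps)
    finally show False by simp
  qed
  define \<sigma> where "\<sigma> = (\<lambda>i j. \<rho> i j - \<rho> i n * \<rho> n j / \<rho> n n)"
  have "\<exists>L. decomposes n \<sigma> L"
  proof (rule Suc.IH)
    show "\<sigma> j i = cnj (\<sigma> i j)" if "i < n" "j < n" for i j
      using herm[of i j] herm[of i n] herm[of n j] herm[of n n] that by (simp add: \<sigma>_def mult.commute)
    fix v :: "nat \<Rightarrow> complex"
    define b where "b = (\<Sum>j<n. \<rho> n j * v j)"
    have b': "(\<Sum>i<n. cnj (v i) * \<rho> i n) = cnj b"
      unfolding b_def cnj_sum using herm[of n] by (intro sum.cong) (auto simp: mult.commute)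
    \<comment> \<open>The last coordinate completes the square, so the form of \<open>\<rho>\<close>
      at \<open>v'\<close> is that of \<open>\<sigma>\<close> at \<open>v\<close>. If
      \<open>\<rho> n n = 0\<close>, it is zero by the convention on division.\<close>
    define v' where "v' = v(n := - b / \<rho> n n)"
    have v': "v' i = v i" if "i < n" for i using that by (simp add: v'_def)
    have v'n: "v' n = - b / \<rho> n n" by (simp add: v'_def)
    have s1: "(\<Sum>i<n. \<Sum>j<n. cnj (v' i) * \<rho> i j * v' j) = (\<Sum>i<n. \<Sum>j<n. cnj (v i) * \<rho> i j * v j)"
      by (intro sum.cong) (auto simp: v')
    have s2: "(\<Sum>i<n. cnj (v' i) * \<rho> i n) = cnj b" unfolding b'[symmetric] by (intro sum.cong) (auto simp: v')
    have s3: "(\<Sum>j<n. \<rho> n j * v' j) = b" unfolding b_def by (intro sum.cong) (auto simp: v')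
    have "(\<Sum>i<n. \<Sum>j<n. cnj (v i) * \<sigma> i j * v j)
        = (\<Sum>i<n. \<Sum>j<n. cnj (v i) * \<rho> i j * v j) - (\<Sum>i<n. \<Sum>j<n. (cnj (v i) * \<rho> i n) * (\<rho> n j * v j)) / \<rho> n n"
      by (simp add: \<sigma>_def sum_subtractf sum_divide_distrib algebra_simps)
    also have "(\<Sum>i<n. \<Sum>j<n. (cnj (v i) * \<rho> i n) * (\<rho> n j * v j)) = cnj b * b"
      unfolding sum_product[symmetric] b' b_def ..
    also have "(\<Sum>i<n. \<Sum>j<n. cnj (v i) * \<rho> i j * v j) - cnj b * b / \<rho> n n
        = (\<Sum>i<Suc n. \<Sum>j<Suc n. cnj (v' i) * \<rho> i j * v' j)"
      unfolding quad s1 s2 s3 v'n using herm[of n n] by (cases "\<rho> n n = 0") (auto simp: field_simps)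
    finally show "0 \<le> Re (\<Sum>i<n. \<Sum>j<n. cnj (v i) * \<sigma> i j * v j)" using psd[of v'] by simp
  qed
  then obtain L where L: "decomposes n \<sigma> L" by blast
  define s where "s = complex_of_real (sqrt (Re (\<rho> n n)))"
  have ss: "s * s = \<rho> n n" using nn_nonneg nn_real by (simp add: s_def flip: of_real_mult)
  have cs: "cnj s = s" by (simp add: s_def)
  \<comment> \<open>If \<open>\<rho> n n\<close> vanishes, division by zero makes this the zero
    column, in accordance with \<open>col0\<close>.\<close>
  define col where "col = (\<lambda>i. \<rho> i n / s)"
  have s0: "s = 0 \<longleftrightarrow> \<rho> n n = 0" using ss by auto
  have "decomposes (Suc n) \<rho> (col # map (\<lambda>v. v(n := 0)) L)"
    unfolding decomposes_def
  proof (intro allI impI)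
    fix i j assume ij: "i < Suc n" "j < Suc n"
    have "col i * cnj (col j) = \<rho> i n * cnj (\<rho> j n) / (s * s)"
      by (simp add: col_def cs)
    also have "cnj (\<rho> j n) = \<rho> n j" using herm[of j n] ij by simp
    finally have c: "col i * cnj (col j) = \<rho> i n * \<rho> n j / \<rho> n n" by (simp add: ss)
    consider "i < n" "j < n" | "i = n" | "j = n" "i < n" using ij by linarith
    then show "\<rho> i j = (\<Sum>v\<leftarrow>col # map (\<lambda>v. v(n := 0)) L. v i * cnj (v j))"
    proof cases
      case 1
      then have "(\<Sum>v\<leftarrow>map (\<lambda>v. v(n := 0)) L. v i * cnj (v j)) = \<sigma> i j"
        using L by (simp add: decomposes_def o_def)
      then show ?thesis by (simp add: c \<sigma>_def)
    next
      case 2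
      have "\<rho> n j = 0" if "\<rho> n n = 0"
      proof (cases "j = n")
        case False
        then have "\<rho> j n = 0" using col0 ij that by simp
        then show ?thesis using herm[of j n] ij by simp
      qed (use that in simp)
      then have "\<rho> i j = col i * cnj (col j)" using 2 unfolding c by auto
      then show ?thesis using 2 by (simp add: o_def)
    next
      case 3
      then have "\<rho> i j = col i * cnj (col j)" using col0[of i] unfolding c by auto
      then show ?thesis using 3 by (simp add: o_def)
    qed
  qed
  then show ?case by blast
qed

section \<open>Monogamy of the squared concurrence\<close>

lemma nsq_cong: "(\<And>c. c < d \<Longrightarrow> x c = x' c) \<Longrightarrow> nsq d x = nsq d x'"
  unfolding nsq_def by (intro sum.cong) auto

lemma gramdet_cong:
  "(\<And>c. c < d \<Longrightarrow> x c = x' c) \<Longrightarrow> (\<And>c. c < d \<Longrightarrow> y c = y' c) \<Longrightarrow> gramdet d x y = gramdet d x' y'"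
  unfolding gramdet_def using ip_cong[of d x x' y y'] nsq_cong[of d x x'] nsq_cong[of d y y'] by simp

lemma ip_double: "ip (2 * d) x y = ip d x y + ip d (\<lambda>b. x (d + b)) (\<lambda>b. y (d + b))"
  by (simp add: ip_def sum_double)

text \<open>Let \<open>A\<close>, \<open>B\<close> be the Gram determinants of the two blocks belonging to the basis vectors of
  the second factor. A quarter of the squared concurrence between the first factor and the rest is
  \<open>(\<surd>A + \<surd>B)\<^sup>2\<close> plus the bound of \<open>gram_decomposition\<close>: measuring the second factor in its basis
  accounts for the first summand, \<open>gram_decomposition\<close> for the second.\<close>

lemma pure_monogamy:
  fixes \<psi> :: "nat \<Rightarrow> complex"
  obtains L2 L3 where
    "decomposes (2 * 2) (ptrace_last d (\<lambda>i j. \<psi> i * cnj (\<psi> j))) L2"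
    "decomposes (2 * d) (ptrace_mid 2 d (\<lambda>i j. \<psi> i * cnj (\<psi> j))) L3"
    "(\<Sum>v\<leftarrow>L2. ucost 2 v)\<^sup>2 + (\<Sum>v\<leftarrow>L3. ucost d v)\<^sup>2 \<le> (ucost (2 * d) \<psi>)\<^sup>2"
proof -
  \<comment> \<open>For \<open>i < 4\<close>, block \<open>i\<close> has first index
    \<open>i div 2\<close> and second index \<open>i mod 2\<close>; the Gram matrix of the blocks is
    the state of the first two factors.\<close>
  define V where "V = (\<lambda>i c. \<psi> (i * d + c))"
  define g where "g = (\<lambda>i j. ip d (V i) (V j))"
  define A where "A = gramdet d (V 0) (V 2)"
  define B where "B = gramdet d (V 1) (V 3)"
  have AB: "0 \<le> A" "0 \<le> B" by (simp_all add: A_def B_def gramdet_nonneg)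
  define R where "R = Re (g 0 0 * g 3 3 + g 1 1 * g 2 2 - g 0 2 * g 3 1 - g 2 0 * g 1 3)"
  obtain L2 where L2: "\<And>i j. i < 4 \<Longrightarrow> j < 4 \<Longrightarrow> g i j = (\<Sum>v\<leftarrow>L2. v i * cnj (v j))"
    "(\<Sum>v\<leftarrow>L2. cmod (v 0 * v 3 - v 1 * v 2))\<^sup>2 \<le> R - 2 * sqrt A * sqrt B"
    by (rule gram_decomposition[of d V]) (rule that, simp_all only: g_def R_def A_def B_def)
  have dec2: "decomposes (2 * 2) (ptrace_last d (\<lambda>i j. \<psi> i * cnj (\<psi> j))) L2"
    using L2(1) by (simp add: decomposes_def ptrace_last_def g_def ip_def V_def)
  have cost2: "(\<Sum>v\<leftarrow>L2. ucost 2 v) = 2 * (\<Sum>v\<leftarrow>L2. cmod (v 0 * v 3 - v 1 * v 2))"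
    by (simp add: ucost_2 sum_list_const_mult)
  \<comment> \<open>The unnormalised state after outcome \<open>m\<close> on the second factor; its
    two halves are the blocks \<open>V m\<close> and \<open>V (m + 2)\<close>.\<close>
  define \<phi> where "\<phi> = (\<lambda>m a. \<psi> ((a div d) * (2 * d) + m * d + a mod d))"
  have dec3: "decomposes (2 * d) (ptrace_mid 2 d (\<lambda>i j. \<psi> i * cnj (\<psi> j))) [\<phi> 0, \<phi> 1]"
    by (simp add: decomposes_def ptrace_mid_def \<phi>_def numeral_2_eq_2)
  have "gramdet d (\<phi> m) (\<lambda>b. \<phi> m (d + b)) = gramdet d (V m) (V (m + 2))" for m
    by (rule gramdet_cong) (auto simp: \<phi>_def V_def algebra_simps)
  from this[of 0] this[of 1] have cost3: "(\<Sum>v\<leftarrow>[\<phi> 0, \<phi> 1]. ucost d v) = 2 * (sqrt A + sqrt B)"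
    by (simp add: ucost_def A_def B_def numeral_3_eq_3 numeral_2_eq_2)
  have V: "V 0 = \<psi>" "V 1 = (\<lambda>c. \<psi> (d + c))" "V 2 = (\<lambda>c. \<psi> (2 * d + c))"
    "V 3 = (\<lambda>c. \<psi> (2 * d + (d + c)))"
    by (simp_all add: V_def algebra_simps)
  have ip2: "ip (2 * d) \<psi> \<psi> = g 0 0 + g 1 1"
    "ip (2 * d) (\<lambda>b. \<psi> (2 * d + b)) (\<lambda>b. \<psi> (2 * d + b)) = g 2 2 + g 3 3"
    "ip (2 * d) \<psi> (\<lambda>b. \<psi> (2 * d + b)) = g 0 2 + g 1 3"
    unfolding ip_double g_def V by (rule refl)+
  have g_eq: "ip d (V i) (V j) = g i j" for i j by (simp add: g_def)
  have gc: "cnj (g i j) = g j i" for i j by (simp add: g_def ip_cnj)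
  have gd: "complex_of_real (gramdet n x y) = ip n x x * ip n y y - ip n x y * cnj (ip n x y)" for n x y
    unfolding gramdet_def of_real_diff of_real_mult ip_self complex_norm_square ..
  \<comment> \<open>Products within one value of the second index form \<open>A\<close> and
    \<open>B\<close>; the mixed products form the expression under \<open>Re\<close> in
    \<open>R\<close>.\<close>
  have "complex_of_real (gramdet (2 * d) \<psi> (\<lambda>b. \<psi> (2 * d + b)))
      = of_real A + of_real B + (g 0 0 * g 3 3 + g 1 1 * g 2 2 - g 0 2 * g 3 1 - g 2 0 * g 1 3)"
    unfolding gd A_def B_def ip2 g_eq by (simp add: gc algebra_simps)
  then have "gramdet (2 * d) \<psi> (\<lambda>b. \<psi> (2 * d + b)) = A + B + R"
    unfolding R_def by (metis Re_complex_of_real plus_complex.sel(1))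
  then have "(ucost (2 * d) \<psi>)\<^sup>2 = 4 * (A + B + R)"
    using gramdet_nonneg[of "2 * d" \<psi> "\<lambda>b. \<psi> (2 * d + b)"] by (simp add: ucost_def power_mult_distrib)
  also have "\<dots> = 4 * ((sqrt A + sqrt B)\<^sup>2 + (R - 2 * sqrt A * sqrt B))"
    using AB by (simp add: power2_sum)
  also have "\<dots> \<ge> (2 * (sqrt A + sqrt B))\<^sup>2 + (2 * (\<Sum>v\<leftarrow>L2. cmod (v 0 * v 3 - v 1 * v 2)))\<^sup>2"
    using L2(2) unfolding power_mult_distrib by simp
  finally have "(\<Sum>v\<leftarrow>L2. ucost 2 v)\<^sup>2 + (\<Sum>v\<leftarrow>[\<phi> 0, \<phi> 1]. ucost d v)\<^sup>2 \<le> (ucost (2 * d) \<psi>)\<^sup>2"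
    unfolding cost2 cost3 by simp
  then show ?thesis using that dec2 dec3 by blast
qed

section \<open>From pure to mixed states\<close>

lemma decomposes_append:
  assumes "decomposes N \<rho> L" "decomposes N \<sigma> M"
  shows "decomposes N (\<lambda>i j. \<rho> i j + \<sigma> i j) (L @ M)"
  using assms by (simp add: decomposes_def)

text \<open>The costs of the two reduced states form a plane vector that is additive under
  concatenation, so the triangle inequality for the Euclidean norm sums the bounds for pure
  states.\<close>

lemma mixed_monogamy:
  "\<exists>L2 L3. decomposes (2 * 2) (ptrace_last d (\<lambda>i j. \<Sum>v\<leftarrow>L. v i * cnj (v j))) L2
    \<and> decomposes (2 * d) (ptrace_mid 2 d (\<lambda>i j. \<Sum>v\<leftarrow>L. v i * cnj (v j))) L3
    \<and> sqrt ((\<Sum>v\<leftarrow>L2. ucost 2 v)\<^sup>2 + (\<Sum>v\<leftarrow>L3. ucost d v)\<^sup>2) \<le> (\<Sum>v\<leftarrow>L. ucost (2 * d) v)"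
proof (induction L)
  case Nil
  show ?case
    by (intro exI[of _ "[]"]) (simp add: decomposes_def ptrace_last_def ptrace_mid_def)
next
  case (Cons \<psi> L)
  then obtain L2 L3 where L: "decomposes (2 * 2) (ptrace_last d (\<lambda>i j. \<Sum>v\<leftarrow>L. v i * cnj (v j))) L2"
    "decomposes (2 * d) (ptrace_mid 2 d (\<lambda>i j. \<Sum>v\<leftarrow>L. v i * cnj (v j))) L3"
    "sqrt ((\<Sum>v\<leftarrow>L2. ucost 2 v)\<^sup>2 + (\<Sum>v\<leftarrow>L3. ucost d v)\<^sup>2) \<le> (\<Sum>v\<leftarrow>L. ucost (2 * d) v)"
    by blast
  obtain M2 M3 where M: "decomposes (2 * 2) (ptrace_last d (\<lambda>i j. \<psi> i * cnj (\<psi> j))) M2"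
    "decomposes (2 * d) (ptrace_mid 2 d (\<lambda>i j. \<psi> i * cnj (\<psi> j))) M3"
    "(\<Sum>v\<leftarrow>M2. ucost 2 v)\<^sup>2 + (\<Sum>v\<leftarrow>M3. ucost d v)\<^sup>2 \<le> (ucost (2 * d) \<psi>)\<^sup>2"
    by (rule pure_monogamy)
  have "sqrt ((\<Sum>v\<leftarrow>M2. ucost 2 v)\<^sup>2 + (\<Sum>v\<leftarrow>M3. ucost d v)\<^sup>2) \<le> ucost (2 * d) \<psi>"
    using M(3) ucost_nonneg by (rule real_le_lsqrt[rotated])
  then have "sqrt ((\<Sum>v\<leftarrow>M2 @ L2. ucost 2 v)\<^sup>2 + (\<Sum>v\<leftarrow>M3 @ L3. ucost d v)\<^sup>2)
      \<le> (\<Sum>v\<leftarrow>\<psi> # L. ucost (2 * d) v)"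
    using L(3) real_sqrt_sum_squares_triangle_ineq[of "\<Sum>v\<leftarrow>M2. ucost 2 v" "\<Sum>v\<leftarrow>L2. ucost 2 v"
        "\<Sum>v\<leftarrow>M3. ucost d v" "\<Sum>v\<leftarrow>L3. ucost d v"] by simp
  moreover have "decomposes (2 * 2) (ptrace_last d (\<lambda>i j. \<Sum>v\<leftarrow>\<psi> # L. v i * cnj (v j))) (M2 @ L2)"
    using decomposes_append[OF M(1) L(1)] by (simp add: decomposes_def ptrace_last_def sum.distrib)
  moreover have "decomposes (2 * d) (ptrace_mid 2 d (\<lambda>i j. \<Sum>v\<leftarrow>\<psi> # L. v i * cnj (v j))) (M3 @ L3)"
    using decomposes_append[OF M(2) L(2)] by (simp add: decomposes_def ptrace_mid_def sum.distrib)
  ultimately show ?case by blast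
qed

lemma trace_ptrace_last: "(\<Sum>i<2 * 2. ptrace_last d \<rho> i i) = (\<Sum>i<2 * (2 * d). \<rho> i i)"
  unfolding sum_double ptrace_last_def
  by (simp add: numeral_2_eq_2 algebra_simps)

lemma trace_ptrace_mid: "(\<Sum>i<2 * d. ptrace_mid 2 d \<rho> i i) = (\<Sum>i<2 * (2 * d). \<rho> i i)"
proof -
  have "(\<Sum>i<2 * d. ptrace_mid 2 d \<rho> i i)
      = (\<Sum>c<d. \<rho> c c + \<rho> (d + c) (d + c)) + (\<Sum>c<d. \<rho> (2 * d + c) (2 * d + c) + \<rho> (2 * d + (d + c)) (2 * d + (d + c)))"
    unfolding sum_double ptrace_mid_def
    by (intro arg_cong2[where f = "(+)"] sum.cong) (auto simp: numeral_2_eq_2 algebra_simps)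
  then show ?thesis unfolding sum_double by (simp add: sum.distrib algebra_simps)
qed

lemma monogamy_of_concurrence:
  assumes "is_state (2 * (2 * d)) \<rho>"
  shows "0 \<le> conc 2 2 (ptrace_last d \<rho>)" "0 \<le> conc 2 d (ptrace_mid 2 d \<rho>)"
    "sqrt ((conc 2 2 (ptrace_last d \<rho>))\<^sup>2 + (conc 2 d (ptrace_mid 2 d \<rho>))\<^sup>2) \<le> conc 2 (2 * d) \<rho>"
proof -
  let ?N = "2 * (2 * d)"
  have tr: "(\<Sum>i<?N. \<rho> i i) = 1" using assms unfolding is_state_def by blast
  \<comment> \<open>Proved for every decomposition, so that the infimum over the ensembles of
    \<open>\<rho>\<close> can be taken afterwards.\<close>
  have key: "0 \<le> conc 2 2 (ptrace_last d \<rho>) \<and> 0 \<le> conc 2 d (ptrace_mid 2 d \<rho>)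
      \<and> sqrt ((conc 2 2 (ptrace_last d \<rho>))\<^sup>2 + (conc 2 d (ptrace_mid 2 d \<rho>))\<^sup>2) \<le> (\<Sum>v\<leftarrow>L. ucost (2 * d) v)"
    if L: "decomposes ?N \<rho> L" for L
  proof -
    obtain L2 L3 where L23: "decomposes (2 * 2) (ptrace_last d (\<lambda>i j. \<Sum>v\<leftarrow>L. v i * cnj (v j))) L2"
      "decomposes (2 * d) (ptrace_mid 2 d (\<lambda>i j. \<Sum>v\<leftarrow>L. v i * cnj (v j))) L3"
      "sqrt ((\<Sum>v\<leftarrow>L2. ucost 2 v)\<^sup>2 + (\<Sum>v\<leftarrow>L3. ucost d v)\<^sup>2) \<le> (\<Sum>v\<leftarrow>L. ucost (2 * d) v)"
      using mixed_monogamy[of d L] by blast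
    have \<rho>: "\<rho> i j = (\<Sum>v\<leftarrow>L. v i * cnj (v j))" if "i < ?N" "j < ?N" for i j
      using L that by (simp add: decomposes_def)
    have idx: "i * d + c < ?N" if "i < 4" "c < d" for i c
    proof -
      have "i * d \<le> 3 * d" using that by (intro mult_right_mono) auto
      then show ?thesis using that by linarith
    qed
    have "ptrace_last d \<rho> i j = ptrace_last d (\<lambda>i j. \<Sum>v\<leftarrow>L. v i * cnj (v j)) i j" if "i < 2 * 2" "j < 2 * 2" for i j
      unfolding ptrace_last_def using that by (intro sum.cong) (auto intro!: \<rho> idx)
    then have d2: "decomposes (2 * 2) (ptrace_last d \<rho>) L2"
      using L23(1) unfolding decomposes_def by presburger
    have idx': "a div d * (2 * d) + m * d + a mod d < ?N" if "a < 2 * d" "m < 2" for a m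
    proof -
      have "0 < d" using that by (cases d) auto
      then have "a div d < 2" "a mod d < d" using that by (auto simp: div_less_iff_less_mult)
      then show ?thesis using idx[of "a div d * 2 + m" "a mod d"] that by (simp add: algebra_simps)
    qed
    have "ptrace_mid 2 d \<rho> i j = ptrace_mid 2 d (\<lambda>i j. \<Sum>v\<leftarrow>L. v i * cnj (v j)) i j" if "i < 2 * d" "j < 2 * d" for i j
      unfolding ptrace_mid_def using that by (intro sum.cong) (auto intro!: \<rho> idx')
    then have d3: "decomposes (2 * d) (ptrace_mid 2 d \<rho>) L3"
      using L23(2) unfolding decomposes_def by presburger
    have t2: "(\<Sum>i<2 * 2. ptrace_last d \<rho> i i) = 1" and t3: "(\<Sum>i<2 * d. ptrace_mid 2 d \<rho> i i) = 1"
      unfolding trace_ptrace_last trace_ptrace_mid using tr by simp_all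
    have "sqrt ((conc 2 2 (ptrace_last d \<rho>))\<^sup>2 + (conc 2 d (ptrace_mid 2 d \<rho>))\<^sup>2)
        \<le> sqrt ((\<Sum>v\<leftarrow>L2. ucost 2 v)\<^sup>2 + (\<Sum>v\<leftarrow>L3. ucost d v)\<^sup>2)"
      using conc_le[OF t2 d2] conc_le[OF t3 d3] by (intro real_sqrt_le_mono add_mono power_mono)
    then show ?thesis using L23(3) conc_le(1)[OF t2 d2] conc_le(1)[OF t3 d3] by linarith
  qed
  obtain L where L: "decomposes ?N \<rho> L"
    using psd_decomposes[of ?N \<rho>] assms unfolding is_state_def by blast
  show "0 \<le> conc 2 2 (ptrace_last d \<rho>)" "0 \<le> conc 2 d (ptrace_mid 2 d \<rho>)"
    using key[OF L] by simp_all
  obtain E where "is_ensemble ?N \<rho> E" by (rule decomposes_imp_ensemble[OF tr L])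
  then show "sqrt ((conc 2 2 (ptrace_last d \<rho>))\<^sup>2 + (conc 2 d (ptrace_mid 2 d \<rho>))\<^sup>2) \<le> conc 2 (2 * d) \<rho>"
    unfolding conc_def[of 2 "2 * d"]
  proof (intro cInf_greatest)
    fix x assume "x \<in> {(\<Sum>(p, \<phi>)\<leftarrow>E. p * conc_pure 2 (2 * d) \<phi>) | E. is_ensemble ?N \<rho> E}"
    then obtain E where E: "is_ensemble ?N \<rho> E" "x = (\<Sum>(p, \<phi>)\<leftarrow>E. p * conc_pure 2 (2 * d) \<phi>)" by blast
    obtain L where "decomposes ?N \<rho> L" "(\<Sum>v\<leftarrow>L. ucost (2 * d) v) = x"
      using ensemble_imp_decomposes[OF E(1)] E(2) by blast
    then show "sqrt ((conc 2 2 (ptrace_last d \<rho>))\<^sup>2 + (conc 2 d (ptrace_mid 2 d \<rho>))\<^sup>2) \<le> x"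
      using key by blast
  qed blast
qed

section \<open>Power inequalities\<close>

text \<open>The derivative is
  \<open>t * x powr (- t - 1) * (p powr t - (1 + x) powr (t - 1))\<close>. It is nonnegative because
  \<open>(1 + x) powr (t - 1)\<close> is at most \<open>2 powr (t - 1)\<close>, which for
  \<open>t \<le> 1 / 2\<close> is at most \<open>(1 / 2) powr t\<close>.\<close>

lemma ratio_powr_mono:
  fixes k s t p :: real
  assumes k: "1 \<le> k" "k \<le> s" and t: "0 \<le> t" "t \<le> 1 / 2" and p: "1 / 2 \<le> p"
  shows "((1 + k) powr t - p powr t) / k powr t \<le> ((1 + s) powr t - p powr t) / s powr t"
proof -
  let ?f = "\<lambda>x. ((1 + x) powr t - p powr t) * x powr (- t)"
  have "?f k \<le> ?f s"
  proof (rule DERIV_nonneg_imp_nondecreasing[OF k(2)])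
    fix x assume "k \<le> x" "x \<le> s"
    then have x: "1 \<le> x" using k by linarith
    have D: "(?f has_real_derivative
        (t * (1 + x) powr (t - 1)) * x powr (- t) + ((1 + x) powr t - p powr t) * (- t * x powr (- t - 1))) (at x)"
      using x by (auto intro!: derivative_eq_intros simp: powr_diff)
    have 1: "x powr (- t) = x * x powr (- t - 1)" using x by (simp add: powr_mult_base)
    have 2: "(1 + x) powr t = (1 + x) * (1 + x) powr (t - 1)" using x by (simp add: powr_mult_base)
    have "(t * (1 + x) powr (t - 1)) * x powr (- t) + ((1 + x) powr t - p powr t) * (- t * x powr (- t - 1))
        = t * x powr (- t - 1) * (p powr t - (1 + x) powr (t - 1))"
      unfolding 1 2 by (simp add: algebra_simps)
    moreover have "(1 + x) powr (t - 1) \<le> p powr t"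
    proof -
      have "(1 + x) powr (t - 1) \<le> 2 powr (t - 1)" using x t by (intro powr_mono2') auto
      also have "\<dots> \<le> 2 powr (- t)" using t by (intro powr_mono) auto
      also have "\<dots> = (1 / 2) powr t" by (simp add: powr_minus_divide powr_divide)
      also have "\<dots> \<le> p powr t" using t p by (intro powr_mono2) auto
      finally show ?thesis .
    qed
    ultimately show "\<exists>y. (?f has_real_derivative y) (at x) \<and> 0 \<le> y"
      using D t by (intro exI[of _ "t * x powr (- t - 1) * (p powr t - (1 + x) powr (t - 1))"]) simp
  qed
  then show ?thesis by (simp add: powr_minus_divide)
qed

text \<open>By monotonicity \<open>k\<close> may be replaced by an arbitrarily large
  \<open>s\<close>, where the quotient is at most \<open>1 + 1 / s\<close>.\<close>

lemma ratio_powr_le_1: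
  fixes k t p :: real
  assumes k: "1 \<le> k" and t: "0 \<le> t" "t \<le> 1 / 2" and p: "1 / 2 \<le> p"
  shows "((1 + k) powr t - p powr t) / k powr t \<le> 1"
proof (rule field_le_epsilon)
  fix e :: real assume e: "0 < e"
  define s where "s = max k (1 / e)"
  have s: "k \<le> s" "1 \<le> s" "1 / e \<le> s" using k by (auto simp: s_def)
  then have se: "1 / s \<le> e" using e by (simp add: field_simps)
  have "((1 + k) powr t - p powr t) / k powr t \<le> ((1 + s) powr t - p powr t) / s powr t"
    using ratio_powr_mono[OF k s(1) t p] .
  also have "\<dots> \<le> (1 + s) powr t / s powr t" by (intro divide_right_mono) auto
  also have "\<dots> = (1 + 1 / s) powr t" using s by (simp add: powr_divide[symmetric] add_divide_distrib add.commute)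
  also have "\<dots> \<le> (1 + 1 / s) powr 1" using s t by (intro powr_mono) auto
  also have "\<dots> \<le> 1 + e" using s se by simp
  finally show "((1 + k) powr t - p powr t) / k powr t \<le> 1 + e" .
qed

text \<open>After division by the norm \<open>z\<close>, both numbers lie in the unit interval,
  where the power \<open>r\<close> is at most the square.\<close>

lemma powr_superadditive_sqrt:
  fixes x y r :: real
  assumes "0 \<le> x" "0 \<le> y" "2 \<le> r"
  shows "x powr r + y powr r \<le> sqrt (x\<^sup>2 + y\<^sup>2) powr r"
proof (cases "x = 0 \<and> y = 0")
  case False
  define z where "z = sqrt (x\<^sup>2 + y\<^sup>2)"
  have z: "0 < z" using False by (simp add: z_def sum_power2_gt_zero_iff)
  have z2: "z\<^sup>2 = x\<^sup>2 + y\<^sup>2" by (simp add: z_def)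
  have *: "(w / z) powr r \<le> (w / z)\<^sup>2" if "0 \<le> w" "w\<^sup>2 \<le> z\<^sup>2" for w
  proof (cases "w = 0")
    case False
    have "w \<le> z" using that z by (simp add: abs_le_square_iff[symmetric])
    then have "(w / z) powr r \<le> (w / z) powr 2"
      using that False z assms by (intro powr_mono') auto
    then show ?thesis using that False z by (simp add: powr_numeral)
  qed simp
  have "(x / z) powr r + (y / z) powr r \<le> (x / z)\<^sup>2 + (y / z)\<^sup>2"
    using assms by (intro add_mono *) (auto simp: z2)
  also have "\<dots> = z\<^sup>2 / z\<^sup>2" unfolding power_divide add_divide_distrib[symmetric] z2 ..
  also have "\<dots> = 1" using z by simp
  finally have "(x powr r + y powr r) / z powr r \<le> 1"
    using assms z by (simp add: powr_divide add_divide_distrib)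
  then show ?thesis using z by (simp add: z_def[symmetric] divide_le_eq)
qed simp

text \<open>For positive \<open>x\<close>, division by \<open>x powr \<alpha>\<close> leaves a claim
  about \<open>s = y powr r / x powr r \<ge> k\<close>, namely that \<open>l\<close> is at most the
  quotient of \<open>ratio_powr_mono\<close> at \<open>s\<close>.\<close>

lemma weighted_powr_bound:
  fixes x y z k p r \<alpha> :: real
  assumes xyz: "0 \<le> x" "0 \<le> y" "sqrt (x\<^sup>2 + y\<^sup>2) \<le> z"
    and k: "k \<ge> 1" and p: "1 / 2 \<le> p" and r: "r \<ge> 2" and \<alpha>: "0 \<le> \<alpha>" "\<alpha> \<le> r / 2"
    and le: "k * x powr r \<le> y powr r"
  shows "p powr (\<alpha> / r) * x powr \<alpha> + ((1 + k) powr (\<alpha> / r) - p powr (\<alpha> / r)) / k powr (\<alpha> / r) * y powr \<alpha> \<le> z powr \<alpha>"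
proof -
  define t where "t = \<alpha> / r"
  define l where "l = ((1 + k) powr t - p powr t) / k powr t"
  have t: "0 \<le> t" "t \<le> 1 / 2" using \<alpha> r by (auto simp: t_def field_simps)
  have \<alpha>_eq: "r * t = \<alpha>" using r by (simp add: t_def)
  show ?thesis unfolding t_def[symmetric] l_def[symmetric]
  proof (cases "x = 0")
    case True
    \<comment> \<open>Since \<open>0 powr \<alpha> = 0\<close> even for \<open>\<alpha> = 0\<close>,
      only \<open>l \<le> 1\<close> has to be used here.\<close>
    have "y \<le> z" using xyz True by simp
    then have "y powr \<alpha> \<le> z powr \<alpha>" using xyz \<alpha> by (intro powr_mono2) auto
    moreover have "l * y powr \<alpha> \<le> 1 * y powr \<alpha>"
      using ratio_powr_le_1[OF k t p] by (intro mult_right_mono) (auto simp: l_def)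
    ultimately show "p powr t * x powr \<alpha> + l * y powr \<alpha> \<le> z powr \<alpha>" using True by simp
  next
    case False
    then have x: "0 < x" using xyz by simp
    then have "0 < x powr r" by simp
    then have "0 < k * x powr r" using k by simp
    then have y: "0 < y" using le xyz by (cases "y = 0") auto
    define s where "s = y powr r / x powr r"
    have s: "k \<le> s" using le x by (simp add: s_def le_divide_eq)
    then have s1: "1 \<le> s" using k by simp
    have st: "s powr t * x powr \<alpha> = y powr \<alpha>"
      using x y by (simp add: s_def powr_divide powr_powr \<alpha>_eq)
    have "l \<le> ((1 + s) powr t - p powr t) / s powr t"
      unfolding l_def by (rule ratio_powr_mono[OF k s t p])
    then have "l * s powr t \<le> (1 + s) powr t - p powr t"
      using s1 by (simp add: le_divide_eq)
    then have "(p powr t + l * s powr t) * x powr \<alpha> \<le> (1 + s) powr t * x powr \<alpha>"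
      by (intro mult_right_mono) auto
    also have "\<dots> = (1 + s) powr t * (x powr r) powr t" by (simp add: powr_powr \<alpha>_eq)
    also have "\<dots> = ((1 + s) * x powr r) powr t"
      by (rule powr_mult[symmetric])
    also have "\<dots> = (x powr r + y powr r) powr t"
      using x by (simp add: s_def distrib_right)
    also have "\<dots> \<le> (sqrt (x\<^sup>2 + y\<^sup>2) powr r) powr t"
      using powr_superadditive_sqrt[OF xyz(1,2) r] t by (intro powr_mono2) auto
    also have "\<dots> \<le> (z powr r) powr t"
      using xyz r t by (intro powr_mono2) auto
    also have "\<dots> = z powr \<alpha>" by (simp add: powr_powr \<alpha>_eq)
    finally show "p powr t * x powr \<alpha> + l * y powr \<alpha> \<le> z powr \<alpha>"
      using st by (simp add: algebra_simps)
  qed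
qed

theorem theorem1:
  fixes n :: nat and \<rho> :: "nat \<Rightarrow> nat \<Rightarrow> complex" and k p r \<alpha> :: real
  assumes "n \<ge> 3"
    and "is_state (2 * 2 * 2 ^ (n - 2)) \<rho>"
    and "k \<ge> 1" and "1 / 2 \<le> p" and "p \<le> 1" and "r \<ge> 2"
    and "0 \<le> \<alpha>" and "\<alpha> \<le> r / 2"
  shows "let d3 = (2::nat) ^ (n - 2);
             C12 = conc 2 2 (ptrace_last d3 \<rho>);
             C13 = conc 2 d3 (ptrace_mid 2 d3 \<rho>);
             C1_23 = conc 2 (2 * d3) \<rho>;
             l = ((1 + k) powr (\<alpha> / r) - p powr (\<alpha> / r)) / k powr (\<alpha> / r)
         in (C13 powr r \<ge> k * C12 powr r \<longrightarrow>
               C1_23 powr \<alpha> \<ge> p powr (\<alpha> / r) * C12 powr \<alpha> + l * C13 powr \<alpha>) \<and>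
            (C12 powr r \<ge> k * C13 powr r \<longrightarrow>
               C1_23 powr \<alpha> \<ge> p powr (\<alpha> / r) * C13 powr \<alpha> + l * C12 powr \<alpha>)"
proof -
  have "is_state (2 * (2 * 2 ^ (n - 2))) \<rho>" using assms(2) by (simp only: mult.assoc)
  note mono = monogamy_of_concurrence[OF this]
  \<comment> \<open>The second claim exchanges the two concurrences, in which the monogamy bound is
    symmetric.\<close>
  from mono(3) have mono': "sqrt ((conc 2 (2 ^ (n - 2)) (ptrace_mid 2 (2 ^ (n - 2)) \<rho>))\<^sup>2
      + (conc 2 2 (ptrace_last (2 ^ (n - 2)) \<rho>))\<^sup>2) \<le> conc 2 (2 * 2 ^ (n - 2)) \<rho>"
    by (simp only: add.commute)
  show ?thesis
    unfolding Let_def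
    by (intro conjI impI)
      (rule weighted_powr_bound[OF mono assms(3,4,6,7,8)],
        assumption, rule weighted_powr_bound[OF mono(2,1) mono' assms(3,4,6,7,8)])
qed

end
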